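(* Let $\mathcal{L}$ be a Lévy operator and $u(t)=e^{-t\mathcal{L}}u_0$ the solution of $\partial_tu+\mathcal{L}u=0$, $u(0)=u_0$. Assume that $\mathcal{L}$ is $p$-hypercontractive for every $p\ge2$ (with coefficient functions $A_p$), and for $2\le p\le q<\infty$ let $t_p^q$ denote the time necessary to get from $L^p$ to $L^q$, so that $$\|e^{-t_p^q\mathcal{L}}u_0\|_q\le A_p(t_p^q)\|u_0\|_p\qquad\text{for all }u_0\in L^p(\mathbb{R}^N).$$ Then, with $p'=\frac{p}{p-1}$ and $q'=\frac{q}{q-1}$, $$\|e^{-t_p^q\mathcal{L}}v_0\|_{p'}\le A_p(t_p^q)\|v_0\|_{q'}\qquad\text{for all }v_0\in L^{q'}(\mathbb{R}^N).$$ Hence one may take $t_{q'}^{p'}=t_p^q$ and, at that time, the coefficient $A_{q'}(t_{q'}^{p'})=A_p(t_p^q)$; therefore $\mathcal{L}$ is $p$-hypercontractive for every $1<p\le2$. Furthermore, if $\mathcal{L}$ is eventually ultracontractive for every $p\ge2$, that is, if for every $p\ge2$ there is a time $T_p$ such that $\|e^{-T_p\mathcal{L}}u_0\|_\infty\le A_p(T_p)\|u_0\|_p$ for all $u_0\in L^p(\mathbb{R}^N)$, then $\mathcal{L}$ is also $1$-hypercontractive, that is, $$\|e^{-T_p\mathcal{L}}v_0\|_{p'}\le A_p(T_p)\|v_0\|_1\qquad\text{for all }v_0\in L^1(\mathbb{R}^N).$$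
   Context: $L^p=L^p(\mathbb{R}^N)$ with Lebesgue measure and norm $\|\cdot\|_p$. A Lévy operator is $\mathcal{L}f(x)=\mathrm{P.V.}\int_{\mathbb{R}^N}(f(x)-f(y))J(x,y)\,dy$ with $J\ge0$ measurable, $J(x,y)=J(y,x)$ and $\sup_x\int J(x,y)\min\{1,|x-y|^2\}\,dy<\infty$. Set $\mathcal{E}(f,g)=\frac12\iint (f(x)-f(y))(g(x)-g(y))J(x,y)\,dx\,dy$, $\overline{\mathcal{E}}(f)=\mathcal{E}(f,f)$, and $H_{\mathcal{L}}(\mathbb{R}^N)=\{f\in L^2:\overline{\mathcal{E}}(f)<\infty\}$; $\mathcal{L}$ is understood as the self-adjoint operator on $L^2$ given by $\langle\mathcal{L}f,g\rangle=\mathcal{E}(f,g)$. For $u_0\in L^2$, the solution of $\partial_tu+\mathcal{L}u=0$, $u(0)=u_0$, is the unique $u\in C([0,\infty);L^2)\cap C^1((0,\infty);L^2)\cap C((0,\infty);H_{\mathcal{L}})$ satisfying $\frac{du}{dt}+\mathcal{L}u=0$ in $(0,\infty)$ and $u(0)=u_0$; write $e^{-t\mathcal{L}}u_0=u(t)$. This semigroup is self-adjoint, positivity preserving and contractive in every $L^p$-norm; for $u_0\in L^p$ the solution is defined by extending $e^{-t\mathcal{L}}$ continuously from $L^2\cap L^p$ to $L^p$. $\mathcal{L}$ is $p$-hypercontractive ($p\in[1,\infty)$) if there are $t_\infty\in(0,\infty]$ and functions $q:[0,t_\infty)\to[p,\infty)$, $A_p:[0,t_\infty)\to[0,\infty)$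 such that $\|u(t)\|_{q(t)}\le A_p(t)\|u_0\|_p$ for $0\le t<t_\infty$ and all $u_0\in L^p$, with $q$ nondecreasing, $q(0)=p$, $\lim_{t\to t_\infty}q(t)=\infty$, and $A_p(0)\ge1$. *)

theory Defs
  imports "HOL-Analysis.Analysis" "HOL-Probability.Essential_Supremum"
begin

section \<open>Lebesgue spaces\<close>

text \<open>Elements of \<open>L\<^sup>p\<close> are represented by functions; equality in \<open>L\<^sup>p\<close> is equality almost
  everywhere.  Finite exponents only.\<close>

definition Lp :: "real \<Rightarrow> ('a::euclidean_space \<Rightarrow> real) set" where
  "Lp p = {f \<in> borel_measurable lebesgue. integrable lebesgue (\<lambda>x. \<bar>f x\<bar> powr p)}"

definition Lp_norm :: "real \<Rightarrow> ('a::euclidean_space \<Rightarrow> real) \<Rightarrow> real" where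
  "Lp_norm p f = (LINT x|lebesgue. \<bar>f x\<bar> powr p) powr (1 / p)"

definition Lp_bound ::
    "(('a::euclidean_space \<Rightarrow> real) \<Rightarrow> 'a \<Rightarrow> real) \<Rightarrow> real \<Rightarrow> real \<Rightarrow> real \<Rightarrow> bool" where
  "Lp_bound T p q C \<longleftrightarrow> (\<forall>f \<in> Lp p. T f \<in> Lp q \<and> Lp_norm q (T f) \<le> C * Lp_norm p f)"

text \<open>\<^const>\<open>esssup\<close> is infinite for non-measurable functions, so the inequality includes
  \<open>T f \<in> L\<^sup>\<infinity>\<close>.\<close>

definition Linf_bound ::
    "(('a::euclidean_space \<Rightarrow> real) \<Rightarrow> 'a \<Rightarrow> real) \<Rightarrow> real \<Rightarrow> real \<Rightarrow> bool" where
  "Linf_bound T p C \<longleftrightarrow>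
     (\<forall>f \<in> Lp p. esssup lebesgue (\<lambda>x. ereal \<bar>T f x\<bar>) \<le> ereal (C * Lp_norm p f))"

section \<open>Levy operators\<close>

text \<open>Measurability of the sections, which Lebesgue measurability on the product gives only for
  almost every \<open>x\<close>, is what makes the integral below meaningful for every \<open>x\<close>.\<close>

definition levy_kernel :: "('a::euclidean_space \<Rightarrow> 'a \<Rightarrow> real) \<Rightarrow> bool" where
  "levy_kernel J \<longleftrightarrow>
     (\<lambda>(x, y). J x y) \<in> borel_measurable lebesgue \<and>
     (\<forall>x. J x \<in> borel_measurable lebesgue) \<and>
     (\<forall>x y. 0 \<le> J x y) \<and>
     (\<forall>x y. J x y = J y x) \<and>
     (SUP x. \<integral>\<^sup>+y. ennreal (J x y * min 1 ((norm (x - y))\<^sup>2)) \<partial>lebesgue) < \<infinity>"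

definition energy ::
    "('a::euclidean_space \<Rightarrow> 'a \<Rightarrow> real) \<Rightarrow> ('a \<Rightarrow> real) \<Rightarrow> ('a \<Rightarrow> real) \<Rightarrow> real" where
  "energy J f g = 1 / 2 * (LINT (x, y)|lebesgue. (f x - f y) * (g x - g y) * J x y)"

text \<open>The integrand of \<open>\<E>(f, f)\<close> is nonnegative and measurable, so integrability says
  \<open>\<E>(f, f) < \<infinity>\<close>.\<close>

definition H_space :: "('a::euclidean_space \<Rightarrow> 'a \<Rightarrow> real) \<Rightarrow> ('a \<Rightarrow> real) set" where
  "H_space J = {f \<in> Lp 2. integrable lebesgue (\<lambda>(x, y). (f x - f y) * (f x - f y) * J x y)}"

definition H_norm :: "('a::euclidean_space \<Rightarrow> 'a \<Rightarrow> real) \<Rightarrow> ('a \<Rightarrow> real) \<Rightarrow> real" where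
  "H_norm J f = sqrt ((Lp_norm 2 f)\<^sup>2 + energy J f f)"

text \<open>The graph of the self-adjoint operator of the form \<open>\<E>\<close>: \<open>f\<close> lies in the domain and
  \<open>\<L> f = h\<close>.\<close>

definition levy_graph ::
    "('a::euclidean_space \<Rightarrow> 'a \<Rightarrow> real) \<Rightarrow> ('a \<Rightarrow> real) \<Rightarrow> ('a \<Rightarrow> real) \<Rightarrow> bool" where
  "levy_graph J f h \<longleftrightarrow> f \<in> H_space J \<and> h \<in> Lp 2 \<and>
     (\<forall>g \<in> H_space J. (LINT x|lebesgue. h x * g x) = energy J f g)"

section \<open>The evolution equation and its semigroup\<close>

text \<open>\<open>u \<in> C([0,\<infinity>); L\<^sup>2) \<inter> C\<^sup>1((0,\<infinity>); L\<^sup>2) \<inter> C((0,\<infinity>); H)\<close>, where \<open>u'\<close> is the time derivative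
  in \<open>L\<^sup>2\<close>, with \<open>u' + \<L> u = 0\<close> on \<open>(0,\<infinity>)\<close> and \<open>u(0) = u\<^sub>0\<close>.\<close>

definition heat_solution ::
    "('a::euclidean_space \<Rightarrow> 'a \<Rightarrow> real) \<Rightarrow> ('a \<Rightarrow> real) \<Rightarrow> (real \<Rightarrow> 'a \<Rightarrow> real) \<Rightarrow> bool" where
  "heat_solution J u0 u \<longleftrightarrow>
     (\<forall>t\<ge>0. u t \<in> Lp 2 \<and>
        ((\<lambda>s. Lp_norm 2 (\<lambda>x. u s x - u t x)) \<longlongrightarrow> 0) (at t within {0..})) \<and>
     (AE x in lebesgue. u 0 x = u0 x) \<and>
     (\<forall>t>0. u t \<in> H_space J \<and>
        ((\<lambda>s. H_norm J (\<lambda>x. u s x - u t x)) \<longlongrightarrow> 0) (at t)) \<and>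
     (\<exists>u'. \<forall>t>0. u' t \<in> Lp 2 \<and>
        ((\<lambda>s. Lp_norm 2 (\<lambda>x. (u s x - u t x) / (s - t) - u' t x)) \<longlongrightarrow> 0) (at t) \<and>
        ((\<lambda>s. Lp_norm 2 (\<lambda>x. u' s x - u' t x)) \<longlongrightarrow> 0) (at t) \<and>
        levy_graph J (u t) (\<lambda>x. - u' t x))"

text \<open>\<open>S t\<close> is \<open>e\<^bsup>-t\<L>\<^esup>\<close>: on \<open>L\<^sup>2\<close> it is the solution operator, on \<open>L\<^sup>p\<close> the extension from
  \<open>L\<^sup>2 \<inter> L\<^sup>p\<close> by continuity.  One map serves all \<open>p\<close>, since the extensions agree almost everywhere
  on intersections.  The two clauses determine \<open>S t f\<close> up to null sets.\<close>

definition heat_semigroup ::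
    "('a::euclidean_space \<Rightarrow> 'a \<Rightarrow> real) \<Rightarrow> (real \<Rightarrow> ('a \<Rightarrow> real) \<Rightarrow> 'a \<Rightarrow> real) \<Rightarrow> bool" where
  "heat_semigroup J S \<longleftrightarrow>
     (\<forall>u0 \<in> Lp 2. heat_solution J u0 (\<lambda>t. S t u0)) \<and>
     (\<forall>p\<ge>1. \<forall>t\<ge>0. \<forall>f \<in> Lp p. S t f \<in> Lp p \<and>
        (\<forall>F :: nat \<Rightarrow> 'a \<Rightarrow> real. (\<forall>n. F n \<in> Lp 2 \<inter> Lp p) \<longrightarrow>
           (\<lambda>n. Lp_norm p (\<lambda>x. F n x - f x)) \<longlonglongrightarrow> 0 \<longrightarrow>
           (\<lambda>n. Lp_norm p (\<lambda>x. S t (F n) x - S t f x)) \<longlonglongrightarrow> 0))"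

section \<open>Hypercontractivity and ultracontractivity\<close>

text \<open>\<open>tinf \<in> (0,\<infinity>]\<close>; the functions \<open>q\<close> and \<open>A\<close> matter only on \<open>[0,tinf)\<close>.\<close>

definition hypercontractive_with ::
    "(real \<Rightarrow> ('a::euclidean_space \<Rightarrow> real) \<Rightarrow> 'a \<Rightarrow> real) \<Rightarrow> real \<Rightarrow> ereal \<Rightarrow>
     (real \<Rightarrow> real) \<Rightarrow> (real \<Rightarrow> real) \<Rightarrow> bool" where
  "hypercontractive_with S p tinf q A \<longleftrightarrow>
     0 < tinf \<and>
     (\<forall>t. 0 \<le> t \<and> ereal t < tinf \<longrightarrow> p \<le> q t \<and> 0 \<le> A t \<and> Lp_bound (S t) p (q t) (A t)) \<and>
     mono_on {t. 0 \<le> t \<and> ereal t < tinf} q \<and>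
     q 0 = p \<and>
     filterlim (\<lambda>t. q (real_of_ereal t)) at_top (at_left tinf) \<and>
     1 \<le> A 0"

definition hypercontractive ::
    "(real \<Rightarrow> ('a::euclidean_space \<Rightarrow> real) \<Rightarrow> 'a \<Rightarrow> real) \<Rightarrow> real \<Rightarrow> bool" where
  "hypercontractive S p \<longleftrightarrow> (\<exists>tinf q A. hypercontractive_with S p tinf q A)"

end

theory Submission
  imports Defs
begin

text \<open>Symmetry and the semigroup law come from one fact: \<open>\<langle>u(s), v(r - s)\<rangle>\<close> is constant in \<open>s\<close> for
  any two solutions \<open>u\<close>, \<open>v\<close>.  Symmetry and the converse Holder inequality turn an
  \<open>L\<^sup>p \<rightarrow> L\<^sup>q\<close> bound into an \<open>L\<^bsup>q'\<^esup> \<rightarrow> L\<^bsup>p'\<^esup>\<close> bound on the dense subspace \<open>L\<^sup>2 \<inter> L\<^bsup>q'\<^esup>\<close>; Fatou's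
  lemma carries it to all of \<open>L\<^bsup>q'\<^esup>\<close>.

  Hypercontractivity also asks for bounds at all the other times.  Boundedness on a single \<open>L\<^sup>p\<close>
  (with some constant) follows from continuity and homogeneity, so the exponent can stay at \<open>q'\<close>
  until time \<open>t\<close>, then at \<open>p'\<close> for the time needed for \<open>L\<^bsup>p'\<^esup> \<rightarrow> L\<^sup>2\<close> (dual to \<open>L\<^sup>2 \<rightarrow> L\<^sup>p\<close>), and then
  follow the hypercontractivity of \<open>L\<^sup>2\<close>.  For \<open>L\<^sup>1\<close> the map is bounded into every \<open>L\<^sup>r\<close> once
  \<open>L\<^sup>1 \<rightarrow> L\<^sup>2 \<rightarrow> L\<^sup>\<infinity>\<close> has happened.\<close>

section \<open>Lebesgue spaces\<close>

lemma Lp_measurable: "f \<in> Lp p \<Longrightarrow> f \<in> borel_measurable lebesgue"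
  by (simp add: Lp_def)

lemma Lp_integrable: "f \<in> Lp p \<Longrightarrow> integrable lebesgue (\<lambda>x. \<bar>f x\<bar> powr p)"
  by (simp add: Lp_def)

lemma Lp_norm_nonneg: "0 \<le> Lp_norm p f"
  by (simp add: Lp_norm_def)

lemma Lp_norm_powr:
  assumes "p > 0"
  shows "Lp_norm p f powr p = (LINT x|lebesgue. \<bar>f x\<bar> powr p)"
  using assms by (simp add: Lp_norm_def powr_powr)

lemma Lp_norm_1: "Lp_norm 1 f = (LINT x|lebesgue. \<bar>f x\<bar>)"
  by (simp add: Lp_norm_def)

lemma Lp_norm_le_iff:
  assumes "p > 0" "K \<ge> 0"
  shows "Lp_norm p f \<le> K \<longleftrightarrow> (LINT x|lebesgue. \<bar>f x\<bar> powr p) \<le> K powr p"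
proof -
  have "Lp_norm p f \<le> K \<longleftrightarrow> Lp_norm p f powr p \<le> K powr p"
    using assms powr_mono2[of p "Lp_norm p f" K] powr_less_mono2[of p K "Lp_norm p f"]
    by (meson Lp_norm_nonneg less_imp_le not_le)
  then show ?thesis using assms by (simp add: Lp_norm_powr)
qed

lemma Lp_dominated:
  fixes f g :: "'a::euclidean_space \<Rightarrow> real"
  assumes f: "f \<in> Lp p" and g: "g \<in> borel_measurable lebesgue" and "p > 0"
    and le: "AE x in lebesgue. \<bar>g x\<bar> \<le> \<bar>f x\<bar>"
  shows "g \<in> Lp p" "Lp_norm p g \<le> Lp_norm p f"
proof -
  have le': "AE x in lebesgue. \<bar>g x\<bar> powr p \<le> \<bar>f x\<bar> powr p"
    using le by eventually_elim (use \<open>p > 0\<close> in \<open>auto intro: powr_mono2\<close>)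
  have int: "integrable lebesgue (\<lambda>x. \<bar>g x\<bar> powr p)"
    by (rule Bochner_Integration.integrable_bound[OF Lp_integrable[OF f]], use g in measurable)
      (use le' in simp)
  then show "g \<in> Lp p" using g by (simp add: Lp_def)
  have "(LINT x|lebesgue. \<bar>g x\<bar> powr p) \<le> (LINT x|lebesgue. \<bar>f x\<bar> powr p)"
    by (rule integral_mono_AE[OF int Lp_integrable[OF f] le'])
  then show "Lp_norm p g \<le> Lp_norm p f"
    using \<open>p > 0\<close> by (simp add: Lp_norm_le_iff Lp_norm_nonneg Lp_norm_powr)
qed

lemma Lp_norm_cong_AE:
  fixes f g :: "'a::euclidean_space \<Rightarrow> real"
  assumes "AE x in lebesgue. f x = g x" "f \<in> borel_measurable lebesgue" "g \<in> borel_measurable lebesgue"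
  shows "Lp_norm p f = Lp_norm p g"
  unfolding Lp_norm_def
  by (rule arg_cong[where f="\<lambda>c. c powr (1 / p)"], rule integral_cong_AE) (use assms in auto)

lemma Lp_cong_AE:
  fixes f g :: "'a::euclidean_space \<Rightarrow> real"
  assumes "AE x in lebesgue. f x = g x" "f \<in> Lp p" "g \<in> borel_measurable lebesgue" "p > 0"
  shows "g \<in> Lp p"
  by (rule Lp_dominated(1)[OF assms(2,3,4)]) (use assms(1) in auto)

lemma Lp_cmult:
  assumes "f \<in> Lp p"
  shows "(\<lambda>x. c * f x) \<in> Lp p"
  using assms by (auto simp: Lp_def abs_mult powr_mult)

lemma Lp_norm_cmult:
  assumes "p > 0"
  shows "Lp_norm p (\<lambda>x. c * f x) = \<bar>c\<bar> * Lp_norm p f"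
  using assms by (simp add: Lp_norm_def abs_mult powr_mult powr_powr)

lemma Lp_diff:
  fixes f g :: "'a::euclidean_space \<Rightarrow> real"
  assumes "f \<in> Lp p" "g \<in> Lp p" "p > 0"
  shows "(\<lambda>x. f x - g x) \<in> Lp p"
proof -
  have meas: "f \<in> borel_measurable lebesgue" "g \<in> borel_measurable lebesgue"
    using assms Lp_measurable by auto
  \<comment> \<open>Comparing with twice the larger modulus avoids convexity, so exponents below 1
    are covered as well.\<close>
  have bd: "\<bar>f x - g x\<bar> powr p \<le> 2 powr p * (\<bar>f x\<bar> powr p + \<bar>g x\<bar> powr p)" for x
  proof -
    have "\<bar>f x - g x\<bar> powr p \<le> (2 * max \<bar>f x\<bar> \<bar>g x\<bar>) powr p"
      by (rule powr_mono2) (use assms in auto)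
    also have "\<dots> = 2 powr p * max \<bar>f x\<bar> \<bar>g x\<bar> powr p"
      by (simp add: powr_mult)
    also have "\<dots> \<le> 2 powr p * (\<bar>f x\<bar> powr p + \<bar>g x\<bar> powr p)"
      by (intro mult_left_mono) (auto simp: max_def)
    finally show ?thesis .
  qed
  have "integrable lebesgue (\<lambda>x. \<bar>f x - g x\<bar> powr p)"
  proof (rule Bochner_Integration.integrable_bound)
    show "integrable lebesgue (\<lambda>x. 2 powr p * (\<bar>f x\<bar> powr p + \<bar>g x\<bar> powr p))"
      using assms by (auto intro!: integrable_mult_right Bochner_Integration.integrable_add Lp_integrable)
  qed (use meas bd in auto)
  then show ?thesis using meas by (simp add: Lp_def)
qed

lemma Lp_norm_eq_0_iff:
  fixes f :: "'a::euclidean_space \<Rightarrow> real"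
  assumes "f \<in> Lp p" "p > 0"
  shows "Lp_norm p f = 0 \<longleftrightarrow> (AE x in lebesgue. f x = 0)"
proof -
  have "Lp_norm p f = 0 \<longleftrightarrow> (LINT x|lebesgue. \<bar>f x\<bar> powr p) = 0"
    using assms by (simp add: Lp_norm_def)
  also have "\<dots> \<longleftrightarrow> (AE x in lebesgue. \<bar>f x\<bar> powr p = 0)"
    by (rule integral_nonneg_eq_0_iff_AE[OF Lp_integrable[OF assms(1)]]) auto
  finally show ?thesis by simp
qed

section \<open>Truncation, limits almost everywhere, and density of intersections\<close>

lemma truncation_Lp:
  fixes f g :: "'a::euclidean_space \<Rightarrow> real"
  assumes f: "f \<in> Lp p" and g: "g \<in> borel_measurable lebesgue" and "p > 0" "r > 0" "e > 0"
    and bd: "\<And>x. \<bar>g x\<bar> \<le> M" and supp: "\<And>x. \<bar>f x\<bar> < e \<Longrightarrow> g x = 0"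
  shows "g \<in> Lp r"
proof -
  \<comment> \<open>Chebyshev's inequality in pointwise form: wherever \<open>g\<close> may be
    nonzero, \<open>\<bar>f x\<bar>\<close> is at least \<open>e\<close>, so the constant
    \<open>M powr r\<close> is dominated by a multiple of
    \<open>\<bar>f x\<bar> powr p\<close>.\<close>
  have le: "\<bar>g x\<bar> powr r \<le> M powr r / e powr p * \<bar>f x\<bar> powr p" for x
  proof (cases "\<bar>f x\<bar> < e")
    case False
    have "\<bar>g x\<bar> powr r \<le> M powr r" using bd[of x] \<open>r > 0\<close> by (auto intro: powr_mono2)
    also have "\<dots> = M powr r / e powr p * e powr p" using \<open>e > 0\<close> by simp
    also have "\<dots> \<le> M powr r / e powr p * \<bar>f x\<bar> powr p"
      using False \<open>e > 0\<close> \<open>p > 0\<close> by (intro mult_left_mono powr_mono2) auto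
    finally show ?thesis .
  qed (use supp in auto)
  have "integrable lebesgue (\<lambda>x. \<bar>g x\<bar> powr r)"
    by (rule Bochner_Integration.integrable_bound[OF integrable_mult_right[OF Lp_integrable[OF f], of "M powr r / e powr p"]])
      (use g le in auto)
  then show ?thesis using g by (simp add: Lp_def)
qed

text \<open>Fatou's lemma for the \<open>q\<close>-th powers. This is how uniform bounds on
  approximations pass to a limit whose membership in L^q is not yet known.\<close>

lemma Lp_Fatou:
  fixes F :: "nat \<Rightarrow> 'a::euclidean_space \<Rightarrow> real"
  assumes F: "\<And>n. F n \<in> Lp q" and f: "f \<in> borel_measurable lebesgue" and "q > 0" "K \<ge> 0"
    and lim: "AE x in lebesgue. (\<lambda>n. F n x) \<longlonglongrightarrow> f x"
    and bd: "\<And>n. Lp_norm q (F n) \<le> K"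
  shows "f \<in> Lp q" "Lp_norm q f \<le> K"
proof -
  note [measurable] = f Lp_measurable[OF F]
  have "(\<integral>\<^sup>+x. ennreal (\<bar>f x\<bar> powr q) \<partial>lebesgue) =
        (\<integral>\<^sup>+x. liminf (\<lambda>n. ennreal (\<bar>F n x\<bar> powr q)) \<partial>lebesgue)"
  proof (rule nn_integral_cong_AE)
    show "AE x in lebesgue. ennreal (\<bar>f x\<bar> powr q) = liminf (\<lambda>n. ennreal (\<bar>F n x\<bar> powr q))"
      using lim
    proof eventually_elim
      case (elim x)
      have "(\<lambda>n. ennreal (\<bar>F n x\<bar> powr q)) \<longlonglongrightarrow> ennreal (\<bar>f x\<bar> powr q)"
        by (rule tendsto_ennrealI, rule tendsto_powr2)
          (use elim \<open>q > 0\<close> in \<open>auto intro!: tendsto_intros\<close>)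
      then show ?case by (rule lim_imp_Liminf[symmetric, OF trivial_limit_sequentially])
    qed
  qed
  also have "\<dots> \<le> liminf (\<lambda>n. \<integral>\<^sup>+x. ennreal (\<bar>F n x\<bar> powr q) \<partial>lebesgue)"
    by (rule nn_integral_liminf) auto
  also have "\<dots> \<le> ennreal (K powr q)"
  proof (rule Liminf_le)
    show "\<forall>\<^sub>F n in sequentially. (\<integral>\<^sup>+x. ennreal (\<bar>F n x\<bar> powr q) \<partial>lebesgue) \<le> ennreal (K powr q)"
    proof (rule always_eventually, rule allI)
      fix n
      have "(\<integral>\<^sup>+x. ennreal (\<bar>F n x\<bar> powr q) \<partial>lebesgue) = ennreal (LINT x|lebesgue. \<bar>F n x\<bar> powr q)"
        by (rule nn_integral_eq_integral[OF Lp_integrable[OF F]]) auto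
      also have "\<dots> \<le> ennreal (K powr q)"
        using bd[of n] \<open>q > 0\<close> \<open>K \<ge> 0\<close> by (intro ennreal_leI) (simp add: Lp_norm_le_iff)
      finally show "(\<integral>\<^sup>+x. ennreal (\<bar>F n x\<bar> powr q) \<partial>lebesgue) \<le> ennreal (K powr q)" .
    qed
  qed simp
  finally have le: "(\<integral>\<^sup>+x. ennreal (\<bar>f x\<bar> powr q) \<partial>lebesgue) \<le> ennreal (K powr q)" .
  have int: "integrable lebesgue (\<lambda>x. \<bar>f x\<bar> powr q)"
    by (rule integrableI_bounded) (use le in \<open>auto intro: le_less_trans\<close>)
  then show "f \<in> Lp q" using f by (simp add: Lp_def)
  have "ennreal (LINT x|lebesgue. \<bar>f x\<bar> powr q) \<le> ennreal (K powr q)"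
    using le nn_integral_eq_integral[OF int] by simp
  then show "Lp_norm q f \<le> K"
    using \<open>q > 0\<close> \<open>K \<ge> 0\<close> by (simp add: Lp_norm_le_iff)
qed

text \<open>Convergence in L^p says that the \<open>p\<close>-th powers of the differences converge
  to 0 in L^1, where the subsequence theorem applies.\<close>

lemma Lp_convergence_AE_subseq:
  fixes F :: "nat \<Rightarrow> 'a::euclidean_space \<Rightarrow> real"
  assumes F: "\<And>n. F n \<in> Lp p" and f: "f \<in> Lp p" and "p > 0"
    and lim: "(\<lambda>n. Lp_norm p (\<lambda>x. F n x - f x)) \<longlonglongrightarrow> 0"
  obtains r where "strict_mono r" "AE x in lebesgue. (\<lambda>n. F (r n) x) \<longlonglongrightarrow> f x"
proof -
  have int: "integrable lebesgue (\<lambda>x. \<bar>F n x - f x\<bar> powr p)" for n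
    by (rule Lp_integrable[OF Lp_diff[OF F f \<open>p > 0\<close>]])
  have "(\<lambda>n. Lp_norm p (\<lambda>x. F n x - f x) powr p) \<longlonglongrightarrow> 0 powr p"
    by (rule tendsto_powr2[OF lim]) (use \<open>p > 0\<close> in \<open>auto simp: Lp_norm_nonneg\<close>)
  then have "(\<lambda>n. LINT x|lebesgue. norm (\<bar>F n x - f x\<bar> powr p)) \<longlonglongrightarrow> 0"
    using \<open>p > 0\<close> by (simp add: Lp_norm_powr)
  from tendsto_L1_AE_subseq[OF int this] obtain r where r: "strict_mono r"
    "AE x in lebesgue. (\<lambda>n. \<bar>F (r n) x - f x\<bar> powr p) \<longlonglongrightarrow> 0" by auto
  have "AE x in lebesgue. (\<lambda>n. F (r n) x) \<longlonglongrightarrow> f x"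
    using r(2)
  proof eventually_elim
    case (elim x)
    have "(\<lambda>n. (\<bar>F (r n) x - f x\<bar> powr p) powr (1 / p)) \<longlonglongrightarrow> 0 powr (1 / p)"
      by (rule tendsto_powr2[OF elim]) (use \<open>p > 0\<close> in auto)
    then have "(\<lambda>n. \<bar>F (r n) x - f x\<bar>) \<longlonglongrightarrow> 0"
      using \<open>p > 0\<close> by (simp add: powr_powr)
    then show ?case by (simp add: LIM_zero_iff tendsto_rabs_zero_iff)
  qed
  with r(1) show ?thesis by (rule that)
qed

text \<open>For \<open>f\<close> in some L^p, the upper cut makes the function bounded and the lower
  cut confines it to a set of finite measure, so the truncation lies in every L^r.
  \<open>Suc n\<close> avoids division by zero.\<close>

definition trunc :: "nat \<Rightarrow> ('a \<Rightarrow> real) \<Rightarrow> 'a \<Rightarrow> real" where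
  "trunc n f x = (if 1 / real (Suc n) \<le> \<bar>f x\<bar> \<and> \<bar>f x\<bar> \<le> real (Suc n) then f x else 0)"

lemma trunc_measurable [measurable]:
  assumes [measurable]: "f \<in> borel_measurable M"
  shows "trunc n f \<in> borel_measurable M"
  unfolding trunc_def by measurable

lemma abs_trunc_le: "\<bar>trunc n f x\<bar> \<le> \<bar>f x\<bar>" "\<bar>trunc n f x\<bar> \<le> real (Suc n)"
  by (auto simp: trunc_def)

lemma trunc_eq_0: "\<bar>f x\<bar> < 1 / real (Suc n) \<Longrightarrow> trunc n f x = 0"
  by (auto simp: trunc_def)

lemma trunc_tendsto: "(\<lambda>n. trunc n f x) \<longlonglongrightarrow> f x"
proof (cases "f x = 0")
  case False
  obtain N1 where N1: "1 / real (Suc N1) < \<bar>f x\<bar>"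
    using False reals_Archimedean[of "\<bar>f x\<bar>"] by (auto simp: inverse_eq_divide)
  obtain N2 where N2: "\<bar>f x\<bar> \<le> real N2" using real_arch_simple by blast
  have "trunc n f x = f x" if "n \<ge> max N1 N2" for n
  proof -
    have "1 / real (Suc n) \<le> 1 / real (Suc N1)" using that by (simp add: frac_le)
    then show ?thesis using that N1 N2 by (auto simp: trunc_def)
  qed
  then show ?thesis
    by (intro tendsto_eventually) (use eventually_sequentially in blast)
qed (simp add: trunc_def)

lemma trunc_Lp:
  fixes f :: "'a::euclidean_space \<Rightarrow> real"
  assumes "f \<in> Lp p" "p > 0" "r > 0"
  shows "trunc n f \<in> Lp r"
  by (rule truncation_Lp[OF assms(1) trunc_measurable[OF Lp_measurable[OF assms(1)]] assms(2,3)
        _ abs_trunc_le(2) trunc_eq_0]) auto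

text \<open>Truncations converge by dominated convergence. Their norms never exceed that of
  \<open>f\<close>, which later lets operator bounds pass to the limit with the same
  constant.\<close>

lemma Lp_dense:
  fixes f :: "'a::euclidean_space \<Rightarrow> real"
  assumes f: "f \<in> Lp p" and "p > 0" "r > 0"
  obtains F where "\<And>n. F n \<in> Lp r \<inter> Lp p" "\<And>n. Lp_norm p (F n) \<le> Lp_norm p f"
    "(\<lambda>n. Lp_norm p (\<lambda>x. F n x - f x)) \<longlonglongrightarrow> 0"
proof -
  note [measurable] = Lp_measurable[OF f]
  have le: "Lp_norm p (trunc n f) \<le> Lp_norm p f" for n
    by (rule Lp_dominated(2)[OF f _ \<open>p > 0\<close>]) (auto simp: abs_trunc_le)
  have "(\<lambda>n. LINT x|lebesgue. \<bar>trunc n f x - f x\<bar> powr p) \<longlonglongrightarrow> (LINT x|(lebesgue :: 'a measure). 0)"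
  proof (rule integral_dominated_convergence[where w="\<lambda>x. \<bar>f x\<bar> powr p"])
    show "integrable lebesgue (\<lambda>x. \<bar>f x\<bar> powr p)" by (rule Lp_integrable[OF f])
    show "AE x in lebesgue. (\<lambda>n. \<bar>trunc n f x - f x\<bar> powr p) \<longlonglongrightarrow> 0"
    proof (rule AE_I2)
      fix x
      have "(\<lambda>n. \<bar>trunc n f x - f x\<bar> powr p) \<longlonglongrightarrow> 0 powr p"
        by (rule tendsto_powr2[OF tendsto_rabs_zero[OF LIM_zero[OF trunc_tendsto]]])
          (use \<open>p > 0\<close> in auto)
      then show "(\<lambda>n. \<bar>trunc n f x - f x\<bar> powr p) \<longlonglongrightarrow> 0" by simp
    qed
    show "AE x in lebesgue. norm (\<bar>trunc n f x - f x\<bar> powr p) \<le> \<bar>f x\<bar> powr p" for n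
      using \<open>p > 0\<close> by (auto simp: trunc_def)
  qed measurable
  then have "(\<lambda>n. (LINT x|lebesgue. \<bar>trunc n f x - f x\<bar> powr p) powr (1 / p)) \<longlonglongrightarrow> 0 powr (1 / p)"
    by (intro tendsto_powr2) (use \<open>p > 0\<close> in auto)
  then have "(\<lambda>n. Lp_norm p (\<lambda>x. trunc n f x - f x)) \<longlonglongrightarrow> 0"
    using \<open>p > 0\<close> by (simp add: Lp_norm_def)
  moreover have "trunc n f \<in> Lp r \<inter> Lp p" for n
    using trunc_Lp[OF f \<open>p > 0\<close>] assms by auto
  ultimately show ?thesis by (intro that[of "\<lambda>n. trunc n f"] le)
qed

section \<open>Hoelder's inequality and its converse\<close>

lemma Holder_inequality:
  fixes f g :: "'a::euclidean_space \<Rightarrow> real"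
  assumes p: "p > 1" "q > 1" "1 / p + 1 / q = 1" and f: "f \<in> Lp p" and g: "g \<in> Lp q"
  shows "integrable lebesgue (\<lambda>x. f x * g x)"
    "\<bar>LINT x|lebesgue. f x * g x\<bar> \<le> Lp_norm p f * Lp_norm q g"
proof -
  note [measurable] = Lp_measurable[OF f] Lp_measurable[OF g]
  \<comment> \<open>Young's inequality is applied to \<open>s * \<bar>f x\<bar>\<close> and
    \<open>\<bar>g x\<bar> / s\<close>, whose product does not depend on \<open>s\<close>; the scale
    is optimised only after integrating.\<close>
  have young: "\<bar>f x * g x\<bar> \<le> \<bar>f x\<bar> powr p / p * a + \<bar>g x\<bar> powr q / q * b"
    if "s > 0" "a = s powr p" "b = (1 / s) powr q" for s a b x
  proof -
    have "\<bar>f x * g x\<bar> = (s * \<bar>f x\<bar>) * (1 / s * \<bar>g x\<bar>)"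
      using that by (simp add: abs_mult)
    also have "\<dots> \<le> (s * \<bar>f x\<bar>) powr p / p + (1 / s * \<bar>g x\<bar>) powr q / q"
      by (rule Youngs_inequality) (use p that in auto)
    also have "\<dots> = \<bar>f x\<bar> powr p / p * a + \<bar>g x\<bar> powr q / q * b"
      using that by (simp only: powr_mult that) (simp add: mult.commute)
    finally show ?thesis .
  qed
  have intr: "integrable lebesgue (\<lambda>x. \<bar>f x\<bar> powr p / p * a + \<bar>g x\<bar> powr q / q * b)" for a b
    using Lp_integrable[OF f] Lp_integrable[OF g] by auto
  show int: "integrable lebesgue (\<lambda>x. f x * g x)"
    by (rule Bochner_Integration.integrable_bound[OF intr[of 1 1]])
      (use young[of 1] p in \<open>auto intro!: AE_I2\<close>)
  have main: "\<bar>LINT x|lebesgue. f x * g x\<bar> \<le> (s * Lp_norm p f) powr p / p + (1 / s * Lp_norm q g) powr q / q"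
    if "s > 0" for s
  proof -
    have "\<bar>LINT x|lebesgue. f x * g x\<bar> \<le> (LINT x|lebesgue. \<bar>f x * g x\<bar>)"
      by (rule integral_abs_bound)
    also have "\<dots> \<le> (LINT x|lebesgue. \<bar>f x\<bar> powr p / p * s powr p + \<bar>g x\<bar> powr q / q * (1 / s) powr q)"
      by (rule integral_mono) (use int intr young[OF that] in auto)
    also have "\<dots> = (LINT x|lebesgue. \<bar>f x\<bar> powr p) / p * s powr p + (LINT x|lebesgue. \<bar>g x\<bar> powr q) / q * (1 / s) powr q"
      using Lp_integrable[OF f] Lp_integrable[OF g] by (subst Bochner_Integration.integral_add) auto
    also have "\<dots> = (s * Lp_norm p f) powr p / p + (1 / s * Lp_norm q g) powr q / q"
      using p that unfolding powr_mult by (subst (1 2) Lp_norm_powr) (simp_all add: mult.commute)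
    finally show ?thesis .
  qed
  show "\<bar>LINT x|lebesgue. f x * g x\<bar> \<le> Lp_norm p f * Lp_norm q g"
  \<comment> \<open>A vanishing norm must be treated apart, because the optimal scale is a quotient
    of powers of both norms.\<close>
  proof (cases "Lp_norm p f = 0 \<or> Lp_norm q g = 0")
    case True
    then have "AE x in lebesgue. f x * g x = 0"
    proof
      assume "Lp_norm p f = 0"
      then have "AE x in lebesgue. f x = 0" using p f by (simp add: Lp_norm_eq_0_iff)
      then show ?thesis by eventually_elim simp
    next
      assume "Lp_norm q g = 0"
      then have "AE x in lebesgue. g x = 0" using p g by (simp add: Lp_norm_eq_0_iff)
      then show ?thesis by eventually_elim simp
    qed
    then have "(LINT x|lebesgue. f x * g x) = 0" by (rule integral_eq_zero_AE)
    then show ?thesis by (simp add: Lp_norm_nonneg)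
  next
    case False
    define a b where "a = Lp_norm p f" and "b = Lp_norm q g"
    have ab: "a > 0" "b > 0"
      using False Lp_norm_nonneg[of p f] Lp_norm_nonneg[of q g] by (auto simp: a_def b_def less_le)
    have pq: "p * q = p + q" using p by (simp add: field_simps)
    \<comment> \<open>With this scale both terms of Young's inequality become multiples of \<open>a * b\<close>.\<close>
    define s where "s = b powr (1 / p) / a powr (1 / q)"
    have s: "s > 0" using ab by (simp add: s_def)
    have e1: "(s * a) powr p = a * b"
    proof -
      have "s * a = b powr (1 / p) * a powr (1 / p)"
      proof -
        have "a = a powr (1 / p + 1 / q)" using p ab by simp
        then show ?thesis unfolding s_def powr_add using ab by (simp add: field_simps)
      qed
      then show ?thesis using ab p by (simp add: powr_mult powr_powr)
    qed
    have e2: "(1 / s * b) powr q = a * b"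
    proof -
      have "1 / s * b = a powr (1 / q) * b powr (1 / q)"
      proof -
        have "b = b powr (1 / p + 1 / q)" using p ab by simp
        then show ?thesis unfolding s_def powr_add using ab by (simp add: field_simps)
      qed
      then show ?thesis using ab p by (simp add: powr_mult powr_powr)
    qed
    have "\<bar>LINT x|lebesgue. f x * g x\<bar> \<le> a * b / p + a * b / q"
      using main[OF s] e1 e2 by (simp add: a_def b_def)
    also have "\<dots> = a * b * (1 / p + 1 / q)" by (simp add: field_simps)
    finally show ?thesis using p by (simp add: a_def b_def)
  qed
qed

text \<open>Membership in L^q is a conclusion here, so the extremal test function is built from
  truncations of \<open>h\<close>, where it lies in every L^s, and Fatou's lemma removes the
  truncation. Tests in the intersection of L^r and L^p suffice for this.\<close>

lemma converse_Holder:
  fixes h :: "'a::euclidean_space \<Rightarrow> real"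
  assumes h: "h \<in> Lp r" "r > 0" and "p > 1" "q > 1" "1 / p + 1 / q = 1" "K \<ge> 0"
    and bd: "\<And>g. g \<in> Lp r \<Longrightarrow> g \<in> Lp p \<Longrightarrow> (LINT x|lebesgue. h x * g x) \<le> K * Lp_norm p g"
  shows "h \<in> Lp q" "Lp_norm q h \<le> K"
proof -
  note [measurable] = Lp_measurable[OF h(1)]
  have conj: "(q - 1) * p = q" using assms(3-5) by (simp add: field_simps)
  have h_q: "trunc n h \<in> Lp q" for n
    using trunc_Lp[OF h] \<open>q > 1\<close> by simp
  have le: "Lp_norm q (trunc n h) \<le> K" for n
  proof -
    \<comment> \<open>The function for which Hoelder's inequality is an equality: \<open>g\<close>
      times the truncation is its modulus to the power \<open>q\<close>, and so is
      \<open>\<bar>g x\<bar> powr p\<close> since \<open>(q - 1) * p = q\<close>.\<close>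
    define g where "g x = sgn (trunc n h x) * \<bar>trunc n h x\<bar> powr (q - 1)" for x
    define I where "I = (LINT x|lebesgue. \<bar>trunc n h x\<bar> powr q)"
    have [measurable]: "g \<in> borel_measurable lebesgue" unfolding g_def by measurable
    have "\<bar>g x\<bar> \<le> real (Suc n) powr (q - 1)" for x
      unfolding g_def abs_mult using abs_trunc_le(2)[of n h x] \<open>q > 1\<close>
      by (auto simp: sgn_if intro!: powr_mono2)
    then have g_Lp: "g \<in> Lp s" if "s > 0" for s
      by (intro truncation_Lp[OF h(1) _ h(2) that, of g "1 / real (Suc n)" "real (Suc n) powr (q - 1)"])
        (auto simp: g_def trunc_eq_0)
    have "h x * g x = \<bar>trunc n h x\<bar> powr q" for x
    proof (cases "trunc n h x = 0")
      case False
      then have "h x = trunc n h x" by (auto simp: trunc_def split: if_splits)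
      then have "h x * g x = \<bar>trunc n h x\<bar> powr 1 * \<bar>trunc n h x\<bar> powr (q - 1)"
        by (auto simp: g_def sgn_if)
      then show ?thesis using powr_add[of "\<bar>trunc n h x\<bar>" 1 "q - 1"] by simp
    qed (simp add: g_def)
    then have "I = (LINT x|lebesgue. h x * g x)" by (simp add: I_def)
    also have "\<dots> \<le> K * Lp_norm p g" by (rule bd) (use g_Lp h \<open>p > 1\<close> in auto)
    also have "Lp_norm p g = I powr (1 / p)"
    proof -
      have "\<bar>g x\<bar> powr p = \<bar>trunc n h x\<bar> powr q" for x
        by (auto simp: g_def abs_mult sgn_if powr_powr conj)
      then show ?thesis by (simp add: Lp_norm_def I_def)
    qed
    finally have I: "I \<le> K * I powr (1 / p)" .
    show ?thesis
    proof (cases "I = 0")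
      case True
      then show ?thesis using \<open>K \<ge> 0\<close> by (simp add: Lp_norm_def I_def)
    next
      case False
      then have "I > 0" by (simp add: I_def less_le)
      \<comment> \<open>Here \<open>I\<close> is split as
        \<open>I powr (1 / q) * I powr (1 / p)\<close>; the second factor is positive and
        cancels.\<close>
      then have "I powr (1 / q) * I powr (1 / p) \<le> K * I powr (1 / p)"
        using I assms(5) by (simp add: add.commute flip: powr_add)
      then have "I powr (1 / q) \<le> K" using \<open>I > 0\<close> by simp
      then show ?thesis by (simp add: Lp_norm_def I_def)
    qed
  qed
  show "h \<in> Lp q" "Lp_norm q h \<le> K"
    using Lp_Fatou[of "\<lambda>n. trunc n h" q h, OF h_q _ _ \<open>K \<ge> 0\<close> _ le]
      Lp_measurable[OF h(1)] \<open>q > 1\<close> trunc_tendsto[of h] by simp_all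
qed

section \<open>The pairing on L^2\<close>

lemma L2_inner:
  fixes f g :: "'a::euclidean_space \<Rightarrow> real"
  assumes "f \<in> Lp 2" "g \<in> Lp 2"
  shows "integrable lebesgue (\<lambda>x. f x * g x)"
    "\<bar>LINT x|lebesgue. f x * g x\<bar> \<le> Lp_norm 2 f * Lp_norm 2 g"
  using Holder_inequality[of 2 2 f g] assms by auto

lemma L2_eqI:
  fixes f g :: "'a::euclidean_space \<Rightarrow> real"
  assumes f: "f \<in> Lp 2" and g: "g \<in> Lp 2"
    and eq: "\<And>h. h \<in> Lp 2 \<Longrightarrow> (LINT x|lebesgue. f x * h x) = (LINT x|lebesgue. g x * h x)"
  shows "AE x in lebesgue. f x = g x"
proof -
  define h where "h x = f x - g x" for x
  have h: "h \<in> Lp 2" unfolding h_def by (rule Lp_diff[OF f g]) simp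
  have "(LINT x|lebesgue. h x * h x) = (LINT x|lebesgue. f x * h x - g x * h x)"
    by (simp add: h_def algebra_simps)
  also have "\<dots> = 0"
    using eq[OF h] L2_inner(1)[OF f h] L2_inner(1)[OF g h] by simp
  finally have "AE x in lebesgue. h x * h x = 0"
    by (subst (asm) integral_nonneg_eq_0_iff_AE[OF L2_inner(1)[OF h h]]) auto
  then show ?thesis by eventually_elim (simp add: h_def)
qed

text \<open>Expands the difference of the pairings into three terms, each containing a difference
  that tends to 0. Membership is asked only eventually, since difference quotients of a solution are
  controlled only near the point; the filter is arbitrary to serve both continuity and
  differentiation.\<close>

lemma L2_inner_tendsto:
  fixes a b :: "'b \<Rightarrow> 'a::euclidean_space \<Rightarrow> real"
  assumes a: "eventually (\<lambda>s. a s \<in> Lp 2) F" and b: "eventually (\<lambda>s. b s \<in> Lp 2) F"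
    and a0: "a0 \<in> Lp 2" and b0: "b0 \<in> Lp 2"
    and la: "((\<lambda>s. Lp_norm 2 (\<lambda>x. a s x - a0 x)) \<longlongrightarrow> 0) F"
    and lb: "((\<lambda>s. Lp_norm 2 (\<lambda>x. b s x - b0 x)) \<longlongrightarrow> 0) F"
  shows "((\<lambda>s. LINT x|lebesgue. a s x * b s x) \<longlongrightarrow> (LINT x|lebesgue. a0 x * b0 x)) F"
proof -
  define A where "A s = Lp_norm 2 (\<lambda>x. a s x - a0 x)" for s
  define B where "B s = Lp_norm 2 (\<lambda>x. b s x - b0 x)" for s
  have "((\<lambda>s. A s * B s + A s * Lp_norm 2 b0 + Lp_norm 2 a0 * B s)
      \<longlongrightarrow> 0 * 0 + 0 * Lp_norm 2 b0 + Lp_norm 2 a0 * 0) F"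
    by (intro tendsto_intros) (use la lb in \<open>auto simp: A_def B_def\<close>)
  then have lim: "((\<lambda>s. A s * B s + A s * Lp_norm 2 b0 + Lp_norm 2 a0 * B s) \<longlongrightarrow> 0) F" by simp
  have "((\<lambda>s. (LINT x|lebesgue. a s x * b s x) - (LINT x|lebesgue. a0 x * b0 x)) \<longlongrightarrow> 0) F"
  proof (rule Lim_null_comparison[OF _ lim])
    show "\<forall>\<^sub>F s in F. norm ((LINT x|lebesgue. a s x * b s x) - (LINT x|lebesgue. a0 x * b0 x))
        \<le> A s * B s + A s * Lp_norm 2 b0 + Lp_norm 2 a0 * B s"
      using a b
    proof eventually_elim
      case (elim s)
      have da: "(\<lambda>x. a s x - a0 x) \<in> Lp 2" by (rule Lp_diff[OF elim(1) a0]) simp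
      have db: "(\<lambda>x. b s x - b0 x) \<in> Lp 2" by (rule Lp_diff[OF elim(2) b0]) simp
      have "(LINT x|lebesgue. a s x * b s x) - (LINT x|lebesgue. a0 x * b0 x)
          = (LINT x|lebesgue. a s x * b s x - a0 x * b0 x)"
        by (rule Bochner_Integration.integral_diff[symmetric]) (use L2_inner(1) elim a0 b0 in auto)
      also have "\<dots> = (LINT x|lebesgue. (a s x - a0 x) * (b s x - b0 x) + (a s x - a0 x) * b0 x
            + a0 x * (b s x - b0 x))"
        by (simp add: algebra_simps)
      also have "\<dots> = (LINT x|lebesgue. (a s x - a0 x) * (b s x - b0 x))
          + (LINT x|lebesgue. (a s x - a0 x) * b0 x) + (LINT x|lebesgue. a0 x * (b s x - b0 x))"
        using L2_inner(1)[OF da db] L2_inner(1)[OF da b0] L2_inner(1)[OF a0 db] by simp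
      finally show ?case
        using L2_inner(2)[OF da db] L2_inner(2)[OF da b0] L2_inner(2)[OF a0 db]
        unfolding A_def B_def real_norm_def by linarith
    qed
  qed
  then show ?thesis by (simp add: LIM_zero_iff)
qed

text \<open>After division by \<open>M\<close>, an intermediate power is at most the sum of the two
  outer ones. This costs the factor \<open>2 powr (1 / q)\<close>, harmless where only some constant
  is wanted.\<close>

lemma Lp_interpolation:
  fixes h :: "'a::euclidean_space \<Rightarrow> real"
  assumes h0: "h \<in> Lp q0" "Lp_norm q0 h \<le> M" and h1: "h \<in> Lp q1" "Lp_norm q1 h \<le> M"
    and q: "0 < q0" "q0 \<le> q" "q \<le> q1"
  shows "h \<in> Lp q" "Lp_norm q h \<le> 2 powr (1 / q) * M"
proof -
  note [measurable] = Lp_measurable[OF h0(1)]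
  have M: "M \<ge> 0" using h0(2) Lp_norm_nonneg[of q0 h] by linarith
  have "h \<in> Lp q \<and> Lp_norm q h \<le> 2 powr (1 / q) * M"
  proof (cases "M = 0")
    \<comment> \<open>Division by \<open>M\<close> fails here, but a zero norm already forces
      \<open>h\<close> to vanish almost everywhere.\<close>
    case True
    then have "Lp_norm q0 h = 0" using h0(2) Lp_norm_nonneg[of q0 h] by linarith
    then have AE: "AE x in lebesgue. h x = 0" using h0(1) q by (simp add: Lp_norm_eq_0_iff)
    have "(\<lambda>x::'a. 0) \<in> Lp q" by (simp add: Lp_def)
    then have "h \<in> Lp q" by (rule Lp_cong_AE[rotated]) (use q AE in auto)
    moreover have "Lp_norm q h = 0"
      using AE Lp_norm_eq_0_iff[OF \<open>h \<in> Lp q\<close>] q by simp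
    ultimately show ?thesis using True by simp
  next
    case False
    with M have M: "M > 0" by simp
    define w where "w x = M powr q * (\<bar>h x\<bar> powr q0 / M powr q0 + \<bar>h x\<bar> powr q1 / M powr q1)" for x
    have w: "integrable lebesgue w"
      unfolding w_def using Lp_integrable[OF h0(1)] Lp_integrable[OF h1(1)] by auto
    have le: "\<bar>h x\<bar> powr q \<le> w x" for x
    proof -
      define y where "y = \<bar>h x\<bar> / M"
      have y: "y \<ge> 0" using M by (simp add: y_def)
      have "y powr q \<le> y powr q0 + y powr q1"
      proof (cases "y \<le> 1")
        case True
        then have "y powr q \<le> y powr q0" using y q by (intro powr_mono') auto
        then show ?thesis by (simp add: add_increasing2)
      next
        case False
        then have "y powr q \<le> y powr q1" using q by (intro powr_mono) auto
        then show ?thesis by (simp add: add_increasing)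
      qed
      then have "M powr q * y powr q \<le> M powr q * (y powr q0 + y powr q1)"
        by (intro mult_left_mono) auto
      then show ?thesis using M by (simp add: y_def powr_divide w_def)
    qed
    have int: "integrable lebesgue (\<lambda>x. \<bar>h x\<bar> powr q)"
      by (rule Bochner_Integration.integrable_bound[OF w], measurable) (use le in \<open>auto intro!: AE_I2 order.trans[OF le]\<close>)
    have "(LINT x|lebesgue. \<bar>h x\<bar> powr q) \<le> (LINT x|lebesgue. w x)"
      by (rule integral_mono[OF int w le])
    also have "\<dots> = M powr q * ((LINT x|lebesgue. \<bar>h x\<bar> powr q0) / M powr q0
        + (LINT x|lebesgue. \<bar>h x\<bar> powr q1) / M powr q1)"
      unfolding w_def using Lp_integrable[OF h0(1)] Lp_integrable[OF h1(1)] by simp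
    also have "\<dots> \<le> M powr q * (1 + 1)"
      using M q h0(2) h1(2) by (intro mult_left_mono add_mono) (auto simp: Lp_norm_le_iff divide_le_eq)
    also have "\<dots> = (2 powr (1 / q) * M) powr q" using M q by (simp add: powr_mult powr_powr)
    finally have "Lp_norm q h \<le> 2 powr (1 / q) * M"
      using q M by (simp add: Lp_norm_le_iff)
    then show ?thesis using int by (simp add: Lp_def)
  qed
  then show "h \<in> Lp q" "Lp_norm q h \<le> 2 powr (1 / q) * M" by auto
qed

text \<open>Of the \<open>q\<close> powers of \<open>\<bar>h x\<bar>\<close>, \<open>q - p\<close>
  are absorbed by the uniform bound and \<open>p\<close> by the norm.\<close>

lemma Lp_Linf_interpolation:
  fixes h :: "'a::euclidean_space \<Rightarrow> real"
  assumes h: "h \<in> Lp p" "Lp_norm p h \<le> M" and bd: "AE x in lebesgue. \<bar>h x\<bar> \<le> M"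
    and q: "0 < p" "p \<le> q"
  shows "h \<in> Lp q" "Lp_norm q h \<le> M"
proof -
  note [measurable] = Lp_measurable[OF h(1)]
  have M: "M \<ge> 0" using h(2) Lp_norm_nonneg[of p h] by linarith
  have le: "AE x in lebesgue. \<bar>h x\<bar> powr q \<le> M powr (q - p) * \<bar>h x\<bar> powr p"
    using bd
  proof eventually_elim
    case (elim x)
    have "\<bar>h x\<bar> powr q = \<bar>h x\<bar> powr (q - p) * \<bar>h x\<bar> powr p" by (simp flip: powr_add)
    also have "\<dots> \<le> M powr (q - p) * \<bar>h x\<bar> powr p"
      using elim q by (intro mult_right_mono powr_mono2) auto
    finally show ?case .
  qed
  have w: "integrable lebesgue (\<lambda>x. M powr (q - p) * \<bar>h x\<bar> powr p)"
    using Lp_integrable[OF h(1)] by simp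
  have int: "integrable lebesgue (\<lambda>x. \<bar>h x\<bar> powr q)"
    by (rule Bochner_Integration.integrable_bound[OF w], measurable) (use le in simp)
  then show "h \<in> Lp q" by (simp add: Lp_def)
  have "(LINT x|lebesgue. \<bar>h x\<bar> powr q) \<le> (LINT x|lebesgue. M powr (q - p) * \<bar>h x\<bar> powr p)"
    by (rule integral_mono_AE[OF int w le])
  also have "\<dots> \<le> M powr (q - p) * M powr p"
    using h q M by (auto simp: Lp_norm_le_iff intro!: mult_left_mono)
  also have "\<dots> = M powr q" by (simp flip: powr_add)
  finally show "Lp_norm q h \<le> M" using q M by (simp add: Lp_norm_le_iff)
qed

section \<open>Operator bounds, and sets of prescribed measure\<close>

lemma Lp_bound_mono:
  assumes "Lp_bound T p q C" "C \<le> D"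
  shows "Lp_bound T p q D"
  unfolding Lp_bound_def
proof (intro ballI conjI)
  fix f :: "'a \<Rightarrow> real" assume "f \<in> Lp p"
  then have "T f \<in> Lp q" "Lp_norm q (T f) \<le> C * Lp_norm p f" using assms(1) by (auto simp: Lp_bound_def)
  moreover have "C * Lp_norm p f \<le> D * Lp_norm p f"
    by (rule mult_right_mono[OF assms(2) Lp_norm_nonneg])
  ultimately show "T f \<in> Lp q" "Lp_norm q (T f) \<le> D * Lp_norm p f" by auto
qed

lemma Lp_bound_interpolation:
  assumes "Lp_bound T p q0 C0" "Lp_bound T p q1 C1" "0 < q0" "q0 \<le> q" "q \<le> q1"
  shows "\<exists>C\<ge>0. Lp_bound T p q C"
proof -
  define C where "C = max 0 (max C0 C1)"
  have b: "Lp_bound T p q0 C" "Lp_bound T p q1 C"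
    using assms(1,2) by (auto intro: Lp_bound_mono simp: C_def)
  have "Lp_bound T p q (2 powr (1 / q) * C)"
    unfolding Lp_bound_def mult.assoc
    using b Lp_interpolation[OF _ _ _ _ assms(3-5)] unfolding Lp_bound_def by blast
  then show ?thesis by (intro exI[of _ "2 powr (1 / q) * C"]) (simp add: C_def)
qed

lemma exists_lebesgue_measure:
  assumes "m > 0"
  obtains E :: "'a::euclidean_space set" where "E \<in> sets lebesgue" "emeasure lebesgue E = ennreal m"
proof -
  define a where "a = root (DIM('a)) m"
  have a: "a > 0" "a ^ DIM('a) = m" using assms by (auto simp: a_def)
  define E :: "'a set" where "E = cbox 0 (a *\<^sub>R One)"
  have "emeasure lborel E = ennreal (\<Prod>b\<in>Basis. (a *\<^sub>R One - 0) \<bullet> (b::'a))"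
    unfolding E_def using a by (subst emeasure_lborel_cbox) auto
  also have "\<dots> = ennreal m" using a by simp
  finally have "emeasure lebesgue E = ennreal m" by (simp add: E_def)
  then show ?thesis using that[of E] by (simp add: E_def)
qed

section \<open>The heat semigroup\<close>

lemma energy_commute: "energy J f g = energy J g f"
  by (simp add: energy_def mult.commute)

lemma heat_solution_derivative:
  assumes "heat_solution J f u"
  obtains u' where "\<And>t. t > 0 \<Longrightarrow> u' t \<in> Lp 2"
    "\<And>t. t > 0 \<Longrightarrow> ((\<lambda>s. Lp_norm 2 (\<lambda>x. (u s x - u t x) / (s - t) - u' t x)) \<longlongrightarrow> 0) (at t)"
    "\<And>t. t > 0 \<Longrightarrow> levy_graph J (u t) (\<lambda>x. - u' t x)"
proof -
  have "\<exists>u'. \<forall>t>0. u' t \<in> Lp 2 \<and>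
        ((\<lambda>s. Lp_norm 2 (\<lambda>x. (u s x - u t x) / (s - t) - u' t x)) \<longlongrightarrow> 0) (at t) \<and>
        ((\<lambda>s. Lp_norm 2 (\<lambda>x. u' s x - u' t x)) \<longlongrightarrow> 0) (at t) \<and>
        levy_graph J (u t) (\<lambda>x. - u' t x)"
    using assms unfolding heat_solution_def by (elim conjE)
  then obtain u' where u': "\<forall>t>0. u' t \<in> Lp 2 \<and>
        ((\<lambda>s. Lp_norm 2 (\<lambda>x. (u s x - u t x) / (s - t) - u' t x)) \<longlongrightarrow> 0) (at t) \<and>
        ((\<lambda>s. Lp_norm 2 (\<lambda>x. u' s x - u' t x)) \<longlongrightarrow> 0) (at t) \<and>
        levy_graph J (u t) (\<lambda>x. - u' t x)" by (elim exE)
  show ?thesis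
    by (rule that[of u']; insert u'; elim allE impE conjE; assumption)
qed

text \<open>Duhamel's trick: by symmetry of the form, \<open>\<langle>u(s), v(r - s)\<rangle>\<close> has derivative
  \<open>- \<E>(u(s), v(r - s)) + \<E>(v(r - s), u(s)) = 0\<close>.\<close>

lemma heat_solution_inner_const:
  fixes J :: "'a::euclidean_space \<Rightarrow> 'a \<Rightarrow> real"
  assumes u: "heat_solution J f u" and v: "heat_solution J g v" and "0 \<le> a" "0 \<le> b"
  shows "(LINT x|lebesgue. u a x * v b x) = (LINT x|lebesgue. u 0 x * v (a + b) x)"
\<comment> \<open>For \<open>a = 0\<close> both sides coincide. Otherwise \<open>a + b\<close> is
  positive and the interval on which \<open>\<phi>\<close> is studied is nondegenerate.\<close>
proof (cases "a = 0")
  case False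
  define r where "r = a + b"
  have r: "r > 0" "a \<le> r" using False assms(3,4) by (auto simp: r_def)
  define \<phi> where "\<phi> s = (LINT x|lebesgue. u s x * v (r - s) x)" for s
  have uL: "u s \<in> Lp 2" if "s \<ge> 0" for s using u that by (simp add: heat_solution_def)
  have vL: "v s \<in> Lp 2" if "s \<ge> 0" for s using v that by (simp add: heat_solution_def)
  have contu: "((\<lambda>s. Lp_norm 2 (\<lambda>x. u s x - u t x)) \<longlongrightarrow> 0) (at t within {0..r})"
    if "t \<in> {0..r}" for t
    by (rule tendsto_within_subset[of _ _ _ "{0..}"]) (use u that in \<open>auto simp: heat_solution_def\<close>)
  have contv: "((\<lambda>s. Lp_norm 2 (\<lambda>x. v (r - s) x - v (r - t) x)) \<longlongrightarrow> 0) (at t within {0..r})"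
    if "t \<in> {0..r}" for t
  proof (rule filterlim_compose[where f="\<lambda>s. r - s"
        and g="\<lambda>s. Lp_norm 2 (\<lambda>x. v s x - v (r - t) x)"])
    show "((\<lambda>s. Lp_norm 2 (\<lambda>x. v s x - v (r - t) x)) \<longlongrightarrow> 0) (at (r - t) within {0..})"
      using v that by (auto simp: heat_solution_def)
    show "filterlim (\<lambda>s. r - s) (at (r - t) within {0..}) (at t within {0..r})"
      by (auto simp: filterlim_at eventually_at_filter intro!: tendsto_intros)
  qed
  have cont: "continuous_on {0..r} \<phi>"
    unfolding continuous_on_def
  proof
    fix t assume t: "t \<in> {0..r}"
    show "(\<phi> \<longlongrightarrow> \<phi> t) (at t within {0..r})"
      unfolding \<phi>_def
      by (rule L2_inner_tendsto[OF _ _ _ _ contu[OF t] contv[OF t]])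
        (use t in \<open>auto simp: eventually_at_filter intro!: uL vL always_eventually\<close>)
  qed
  obtain u' where u': "\<And>t. t > 0 \<Longrightarrow> u' t \<in> Lp 2"
      "\<And>t. t > 0 \<Longrightarrow> ((\<lambda>s. Lp_norm 2 (\<lambda>x. (u s x - u t x) / (s - t) - u' t x)) \<longlongrightarrow> 0) (at t)"
      "\<And>t. t > 0 \<Longrightarrow> levy_graph J (u t) (\<lambda>x. - u' t x)"
    by (blast intro: heat_solution_derivative[OF u])
  obtain v' where v': "\<And>t. t > 0 \<Longrightarrow> v' t \<in> Lp 2"
      "\<And>t. t > 0 \<Longrightarrow> ((\<lambda>s. Lp_norm 2 (\<lambda>x. (v s x - v t x) / (s - t) - v' t x)) \<longlongrightarrow> 0) (at t)"
      "\<And>t. t > 0 \<Longrightarrow> levy_graph J (v t) (\<lambda>x. - v' t x)"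
    by (blast intro: heat_solution_derivative[OF v])
  have deriv: "(\<phi> has_real_derivative 0) (at t)" if t: "0 < t" "t < r" for t
  proof -
    have at: "at t within {0..r} = at t" using t by (rule at_within_Icc_at)
    have ev: "eventually (\<lambda>s. 0 < s \<and> s < r \<and> s \<noteq> t) (at t)"
      using t eventually_at_in_open'[of "{0<..<r}" t]
      by (auto simp: eventually_at_filter elim: eventually_mono)
    define Du where "Du s x = (u s x - u t x) / (s - t)" for s x
    \<comment> \<open>The denominator is the increment of the reversed time \<open>r - s\<close>, so
      \<open>Dv\<close> converges to \<open>v' (r - t)\<close>; in terms of \<open>s - t\<close> it
      carries a minus sign.\<close>
    define Dv where "Dv s x = (v (r - s) x - v (r - t) x) / ((r - s) - (r - t))" for s x
    have Du_L: "Du s \<in> Lp 2" if "0 < s" for s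
      using Lp_cmult[OF Lp_diff[OF uL uL], of s t "1 / (s - t)"] that t by (simp add: Du_def[abs_def])
    have Dv_L: "Dv s \<in> Lp 2" if "s < r" for s
      using Lp_cmult[OF Lp_diff[OF vL vL], of "r - s" "r - t" "1 / ((r - s) - (r - t))"] that t
      by (simp add: Dv_def[abs_def])
    have Dv_lim: "((\<lambda>s. Lp_norm 2 (\<lambda>x. Dv s x - v' (r - t) x)) \<longlongrightarrow> 0) (at t)"
      unfolding Dv_def
    proof (rule filterlim_compose[where f="\<lambda>s. r - s"
          and g="\<lambda>s. Lp_norm 2 (\<lambda>x. (v s x - v (r - t) x) / (s - (r - t)) - v' (r - t) x)"])
      show "((\<lambda>s. Lp_norm 2 (\<lambda>x. (v s x - v (r - t) x) / (s - (r - t)) - v' (r - t) x)) \<longlongrightarrow> 0) (at (r - t))"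
        using v'(2)[of "r - t"] t by simp
      show "filterlim (\<lambda>s. r - s) (at (r - t)) (at t)"
        by (auto simp: filterlim_at eventually_at_filter intro!: tendsto_intros)
    qed
    have lim1: "((\<lambda>s. LINT x|lebesgue. Du s x * v (r - s) x)
        \<longlongrightarrow> (LINT x|lebesgue. u' t x * v (r - t) x)) (at t)"
    proof (rule L2_inner_tendsto)
      show "((\<lambda>s. Lp_norm 2 (\<lambda>x. Du s x - u' t x)) \<longlongrightarrow> 0) (at t)"
        unfolding Du_def by (rule u'(2)[OF t(1)])
      show "((\<lambda>s. Lp_norm 2 (\<lambda>x. v (r - s) x - v (r - t) x)) \<longlongrightarrow> 0) (at t)"
        using contv[of t] t at by simp
      show "\<forall>\<^sub>F s in at t. Du s \<in> Lp 2" using ev by eventually_elim (auto intro: Du_L)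
      show "\<forall>\<^sub>F s in at t. v (r - s) \<in> Lp 2" using ev by eventually_elim (auto intro: vL)
    qed (use t u' vL in auto)
    have lim2: "((\<lambda>s. LINT x|lebesgue. u t x * Dv s x)
        \<longlongrightarrow> (LINT x|lebesgue. u t x * v' (r - t) x)) (at t)"
    proof (rule L2_inner_tendsto[OF _ _ _ _ _ Dv_lim])
      show "\<forall>\<^sub>F s in at t. Dv s \<in> Lp 2" using ev by eventually_elim (auto intro: Dv_L)
    qed (use t v' uL in \<open>auto simp: Lp_norm_def\<close>)
    \<comment> \<open>The equation for \<open>u\<close> is tested with \<open>v (r - t)\<close>, and
      below the equation for \<open>v\<close> with \<open>u t\<close>; both are admissible because
      solutions lie in \<open>H_space\<close> at positive times.\<close>
    have neg: "(LINT x|lebesgue. u' t x * v (r - t) x) = - energy J (u t) (v (r - t))"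
    proof -
      have "v (r - t) \<in> H_space J" using v t by (simp add: heat_solution_def)
      then have "(LINT x|lebesgue. - u' t x * v (r - t) x) = energy J (u t) (v (r - t))"
        using u'(3)[OF t(1)] by (simp add: levy_graph_def)
      then show ?thesis by simp
    qed
    have pos: "(LINT x|lebesgue. u t x * v' (r - t) x) = - energy J (u t) (v (r - t))"
    proof -
      have "u t \<in> H_space J" using u t by (simp add: heat_solution_def)
      then have "(LINT x|lebesgue. - v' (r - t) x * u t x) = energy J (v (r - t)) (u t)"
        using v'(3)[of "r - t"] t by (simp add: levy_graph_def)
      then show ?thesis by (simp add: energy_commute[of J "u t"] mult.commute)
    qed
    \<comment> \<open>The discrete product rule: this difference is the difference quotient of
      \<open>\<phi>\<close>, and its two limits are the same energy.\<close>
    have "((\<lambda>s. (LINT x|lebesgue. Du s x * v (r - s) x) - (LINT x|lebesgue. u t x * Dv s x)) \<longlongrightarrow> 0) (at t)"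
      using tendsto_diff[OF lim1 lim2] neg pos by simp
    moreover have "\<forall>\<^sub>F s in at t. (LINT x|lebesgue. Du s x * v (r - s) x) - (LINT x|lebesgue. u t x * Dv s x)
        = (\<phi> s - \<phi> t) / (s - t)"
      using ev
    proof eventually_elim
      case (elim s)
      note int = L2_inner(1)[OF uL vL] L2_inner(1)[OF Du_L vL] L2_inner(1)[OF uL Dv_L]
      have "(LINT x|lebesgue. Du s x * v (r - s) x) - (LINT x|lebesgue. u t x * Dv s x)
          = (LINT x|lebesgue. Du s x * v (r - s) x - u t x * Dv s x)"
        by (rule Bochner_Integration.integral_diff[symmetric]) (use int elim t in auto)
      also have "\<dots> = (LINT x|lebesgue. (u s x * v (r - s) x - u t x * v (r - t) x) / (s - t))"
      proof (rule Bochner_Integration.integral_cong[OF refl])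
        fix x
        have quot: "(a - b) / d * c - b * ((c - e) / - d) = (a * c - b * e) / d" for a b c d e :: real
          by (simp add: algebra_simps diff_divide_distrib)
        have "(r - s) - (r - t) = - (s - t)" by simp
        then show "Du s x * v (r - s) x - u t x * Dv s x
            = (u s x * v (r - s) x - u t x * v (r - t) x) / (s - t)"
          unfolding Du_def Dv_def by (simp only: quot)
      qed
      also have "\<dots> = (\<phi> s - \<phi> t) / (s - t)"
        unfolding \<phi>_def integral_divide_zero
        by (subst Bochner_Integration.integral_diff) (use int elim t in auto)
      finally show ?case .
    qed
    ultimately have "((\<lambda>s. (\<phi> s - \<phi> t) / (s - t)) \<longlongrightarrow> 0) (at t)"
      by (rule Lim_transform_eventually)
    then show ?thesis by (simp add: has_field_derivative_iff)
  qed
  have "\<phi> a = \<phi> 0"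
    by (rule DERIV_isconst2[OF r(1) cont]) (use deriv r assms in auto)
  then show ?thesis by (simp add: \<phi>_def r_def)
qed simp

section \<open>Algebra of the semigroup on L^2 and its bounds between Lebesgue spaces\<close>

locale heat_flow =
  fixes J :: "'a::euclidean_space \<Rightarrow> 'a \<Rightarrow> real" and S :: "real \<Rightarrow> ('a \<Rightarrow> real) \<Rightarrow> 'a \<Rightarrow> real"
  assumes semigroup: "heat_semigroup J S"
begin

lemma solution: "f \<in> Lp 2 \<Longrightarrow> heat_solution J f (\<lambda>t. S t f)"
  using semigroup by (simp add: heat_semigroup_def)

lemma S_Lp: "p \<ge> 1 \<Longrightarrow> t \<ge> 0 \<Longrightarrow> f \<in> Lp p \<Longrightarrow> S t f \<in> Lp p"
  using semigroup unfolding heat_semigroup_def by blast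

lemma S_measurable: "f \<in> Lp 2 \<Longrightarrow> t \<ge> 0 \<Longrightarrow> S t f \<in> borel_measurable lebesgue"
  by (rule Lp_measurable[OF S_Lp[of 2]]) auto

lemma S_continuous:
  assumes "p \<ge> 1" "t \<ge> 0" "f \<in> Lp p" "\<And>n. F n \<in> Lp 2 \<inter> Lp p"
    "(\<lambda>n. Lp_norm p (\<lambda>x. F n x - f x)) \<longlonglongrightarrow> 0"
  shows "(\<lambda>n. Lp_norm p (\<lambda>x. S t (F n) x - S t f x)) \<longlonglongrightarrow> 0"
  using semigroup assms unfolding heat_semigroup_def by blast

lemma S_zero: "f \<in> Lp 2 \<Longrightarrow> AE x in lebesgue. S 0 f x = f x"
  using solution by (simp add: heat_solution_def)

text \<open>Constancy of the pairing along the flow, with the initial value put back. The case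
  \<open>b = 0\<close> yields symmetry; general \<open>b\<close> yields the semigroup law.\<close>

lemma inner_shift:
  assumes f: "f \<in> Lp 2" and g: "g \<in> Lp 2" and ab: "0 \<le> a" "0 \<le> b"
  shows "(LINT x|lebesgue. S a f x * S b g x) = (LINT x|lebesgue. f x * S (a + b) g x)"
proof -
  note [measurable] = Lp_measurable[OF f] S_measurable[OF f order.refl]
      S_measurable[OF g add_nonneg_nonneg[OF ab]]
  have "(LINT x|lebesgue. S a f x * S b g x) = (LINT x|lebesgue. S 0 f x * S (a + b) g x)"
    by (rule heat_solution_inner_const[OF solution[OF f] solution[OF g] ab])
  also have "\<dots> = (LINT x|lebesgue. f x * S (a + b) g x)"
    by (rule integral_cong_AE) (use S_zero[OF f] in auto)
  finally show ?thesis .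
qed

lemma S_symmetric:
  assumes f: "f \<in> Lp 2" and g: "g \<in> Lp 2" and t: "0 \<le> t"
  shows "(LINT x|lebesgue. S t f x * g x) = (LINT x|lebesgue. f x * S t g x)"
proof -
  note [measurable] = Lp_measurable[OF g] S_measurable[OF g order.refl] S_measurable[OF f t]
  have "(LINT x|lebesgue. S t f x * g x) = (LINT x|lebesgue. S t f x * S 0 g x)"
    by (rule integral_cong_AE) (use S_zero[OF g] in auto)
  then show ?thesis using inner_shift[OF f g t order.refl] by simp
qed

text \<open>Tested against \<open>h\<close>, both sides become the pairing of \<open>f\<close> with
  \<open>S (s + t) h\<close>: symmetry moves the operators onto \<open>h\<close> and
  \<open>inner_shift\<close> merges the times.\<close>

lemma S_add:
  assumes f: "f \<in> Lp 2" and st: "0 \<le> s" "0 \<le> t"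
  shows "AE x in lebesgue. S (s + t) f x = S s (S t f) x"
proof (rule L2_eqI)
  have Stf: "S t f \<in> Lp 2" by (rule S_Lp) (use f st in auto)
  then show "S (s + t) f \<in> Lp 2" "S s (S t f) \<in> Lp 2" using S_Lp[of 2] f st by auto
  fix h :: "'a \<Rightarrow> real" assume h: "h \<in> Lp 2"
  show "(LINT x|lebesgue. S (s + t) f x * h x) = (LINT x|lebesgue. S s (S t f) x * h x)"
    using S_symmetric[OF f h, of "s + t"] S_symmetric[OF Stf h st(1)] inner_shift[OF f h st(2,1)] st
    by (simp add: add.commute)
qed

text \<open>By symmetry \<open>S t\<close> can be moved onto the test function, after which the
  scalar is simply in front of \<open>f\<close>.\<close>

lemma S_cmult:
  assumes f: "f \<in> Lp 2" and t: "0 \<le> t"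
  shows "AE x in lebesgue. S t (\<lambda>x. c * f x) x = c * S t f x"
proof (rule L2_eqI)
  show "S t (\<lambda>x. c * f x) \<in> Lp 2" "(\<lambda>x. c * S t f x) \<in> Lp 2"
    by (intro S_Lp Lp_cmult f t; simp)+
  fix h :: "'a \<Rightarrow> real" assume h: "h \<in> Lp 2"
  show "(LINT x|lebesgue. S t (\<lambda>x. c * f x) x * h x) = (LINT x|lebesgue. c * S t f x * h x)"
    using S_symmetric[OF Lp_cmult[OF f] h t, of c] S_symmetric[OF f h t] by (simp add: mult.assoc)
qed

text \<open>Symmetry and the semigroup law are available only on L^2. This extends an estimate from
  there to all of L^p: along an approximating sequence the images converge almost everywhere after
  passing to a subsequence, and Fatou's lemma keeps the constant.\<close>

lemma Lp_bound_dense: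
  assumes p: "p \<ge> 1" and q: "q > 0" and t: "t \<ge> 0" and C: "C \<ge> 0"
    and bd: "\<And>f. f \<in> Lp 2 \<Longrightarrow> f \<in> Lp p \<Longrightarrow> S t f \<in> Lp q \<and> Lp_norm q (S t f) \<le> C * Lp_norm p f"
  shows "Lp_bound (S t) p q C"
  unfolding Lp_bound_def
proof
  fix f :: "'a \<Rightarrow> real" assume f: "f \<in> Lp p"
  obtain F where F: "\<And>n. F n \<in> Lp 2 \<inter> Lp p" "\<And>n. Lp_norm p (F n) \<le> Lp_norm p f"
    "(\<lambda>n. Lp_norm p (\<lambda>x. F n x - f x)) \<longlonglongrightarrow> 0"
    using Lp_dense[OF f, of 2] p by auto
  have SF: "S t (F n) \<in> Lp p" for n using S_Lp[OF p t] F(1) by blast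
  have Sf: "S t f \<in> Lp p" by (rule S_Lp[OF p t f])
  obtain r where r: "AE x in lebesgue. (\<lambda>n. S t (F (r n)) x) \<longlonglongrightarrow> S t f x"
    using Lp_convergence_AE_subseq[OF SF Sf _ S_continuous[OF p t f F(1,3)]] p by auto
  have "Lp_norm q (S t (F n)) \<le> C * Lp_norm p f" for n
    using bd[of "F n"] F(1,2)[of n] mult_left_mono[OF F(2)[of n] C] by auto
  moreover have "S t (F n) \<in> Lp q" for n using bd[of "F n"] F(1)[of n] by auto
  ultimately show "S t f \<in> Lp q \<and> Lp_norm q (S t f) \<le> C * Lp_norm p f"
    using Lp_Fatou[of "\<lambda>n. S t (F (r n))" q "S t f" "C * Lp_norm p f"] Lp_measurable[OF Sf] q C r
    by (auto simp: Lp_norm_nonneg)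
qed

text \<open>A homogeneous map that is continuous at 0 is bounded: otherwise suitably scaled
  functions tend to 0 while their images keep norm 1.\<close>

lemma Lp_bound_diag:
  assumes p: "p \<ge> 1" and t: "t \<ge> 0"
  shows "\<exists>C\<ge>0. Lp_bound (S t) p p C"
proof (rule ccontr)
  assume contra: "\<not> ?thesis"
  have "\<exists>f. f \<in> Lp 2 \<and> f \<in> Lp p \<and> real (Suc n) * Lp_norm p f < Lp_norm p (S t f)" for n
  proof (rule ccontr)
    assume "\<not> ?thesis"
    then have "Lp_bound (S t) p p (real (Suc n))"
      by (intro Lp_bound_dense) (use p t S_Lp in \<open>auto simp: not_less\<close>)
    then show False using contra by (meson of_nat_0_le_iff)
  qed
  then obtain f where f: "\<And>n. f n \<in> Lp 2" "\<And>n. f n \<in> Lp p"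
      "\<And>n. real (Suc n) * Lp_norm p (f n) < Lp_norm p (S t (f n))" by metis
  \<comment> \<open>Scaling the image to norm 1 leaves \<open>F n\<close> with norm at most
    \<open>1 / real (Suc n)\<close>, because \<open>f n\<close> violates the bound with constant
    \<open>Suc n\<close>.\<close>
  define c where "c n = 1 / Lp_norm p (S t (f n))" for n
  have pos: "Lp_norm p (S t (f n)) > 0" for n
    using f(3)[of n] Lp_norm_nonneg[of p "f n"] by (smt (verit) mult_nonneg_nonneg of_nat_0_le_iff)
  define F where "F n x = c n * f n x" for n x
  have F: "F n \<in> Lp 2 \<inter> Lp p" for n unfolding F_def using Lp_cmult f by auto
  have zero: "(\<lambda>x. 0) \<in> Lp r" for r by (simp add: Lp_def)
  have small: "Lp_norm p (F n) \<le> 1 / real (Suc n)" for n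
  proof -
    have "Lp_norm p (F n) = c n * Lp_norm p (f n)"
      unfolding F_def using p pos[of n] by (subst Lp_norm_cmult) (auto simp: c_def)
    also have "\<dots> \<le> 1 / real (Suc n)"
      using f(3)[of n] pos[of n] by (simp add: c_def field_simps)
    finally show ?thesis .
  qed
  have "(\<lambda>n. Lp_norm p (F n)) \<longlonglongrightarrow> 0"
    by (rule tendsto_sandwich[OF _ _ tendsto_const LIMSEQ_inverse_real_of_nat])
      (use small in \<open>auto simp: Lp_norm_nonneg inverse_eq_divide\<close>)
  then have lim: "(\<lambda>n. Lp_norm p (\<lambda>x. S t (F n) x - S t (\<lambda>x. 0) x)) \<longlonglongrightarrow> 0"
    by (intro S_continuous[OF p t zero F]) simp
  have one: "Lp_norm p (\<lambda>x. S t (F n) x - S t (\<lambda>x. 0) x) = 1" for n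
  proof -
    \<comment> \<open>Homogeneity with factor 0 shows that the zero function is mapped to
      zero.\<close>
    have AE0: "AE x in lebesgue. S t (\<lambda>x. 0) x = 0"
      using S_cmult[OF zero t, of 0] by simp
    have AEF: "AE x in lebesgue. S t (F n) x = c n * S t (f n) x"
      unfolding F_def by (rule S_cmult[OF f(1) t])
    note [measurable] = S_measurable[OF IntD1[OF F[of n]] t] S_measurable[OF f(1)[of n] t]
      S_measurable[OF zero t]
    have "Lp_norm p (\<lambda>x. S t (F n) x - S t (\<lambda>x. 0) x) = Lp_norm p (\<lambda>x. c n * S t (f n) x)"
      by (rule Lp_norm_cong_AE) (use AE0 AEF in auto)
    also have "\<dots> = 1" using p pos[of n] by (subst Lp_norm_cmult) (auto simp: c_def)
    finally show ?thesis .
  qed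
  show False using lim unfolding one by (simp add: LIMSEQ_const_iff)
qed

text \<open>The semigroup law identifies the composition almost everywhere for \<open>f\<close> in
  L^2; density does the rest.\<close>

lemma Lp_bound_compose:
  assumes s: "Lp_bound (S s) p q C" and t: "Lp_bound (S t) q r D"
    and "s \<ge> 0" "t \<ge> 0" "p \<ge> 1" "r > 0" "C \<ge> 0" "D \<ge> 0"
  shows "Lp_bound (S (s + t)) p r (D * C)"
proof (rule Lp_bound_dense)
  fix f :: "'a \<Rightarrow> real" assume f: "f \<in> Lp 2" "f \<in> Lp p"
  have 1: "S s f \<in> Lp q" "Lp_norm q (S s f) \<le> C * Lp_norm p f" using s f by (auto simp: Lp_bound_def)
  have 2: "S t (S s f) \<in> Lp r" "Lp_norm r (S t (S s f)) \<le> D * Lp_norm q (S s f)"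
    using t 1 by (auto simp: Lp_bound_def)
  have AE: "AE x in lebesgue. S t (S s f) x = S (s + t) f x"
    using S_add[OF f(1) assms(4,3)] by (auto simp: add.commute)
  have m: "S (s + t) f \<in> borel_measurable lebesgue"
    by (rule S_measurable[OF f(1) add_nonneg_nonneg]) fact+
  have "S (s + t) f \<in> Lp r" by (rule Lp_cong_AE[OF AE 2(1) m]) fact
  moreover have "Lp_norm r (S (s + t) f) = Lp_norm r (S t (S s f))"
    by (rule Lp_norm_cong_AE[symmetric, OF AE Lp_measurable[OF 2(1)] m])
  ultimately show "S (s + t) f \<in> Lp r \<and> Lp_norm r (S (s + t) f) \<le> D * C * Lp_norm p f"
    using 2(2) mult_left_mono[OF 1(2) \<open>D \<ge> 0\<close>] by (simp add: mult.assoc)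
qed (use assms in auto)

text \<open>Symmetry moves \<open>S t\<close> onto the test function, Hoelder's inequality uses the
  given bound there, and the converse inequality recovers the norm of \<open>S t f\<close>. That
  \<open>S t f\<close> lies in L^2 lets the tests be restricted to L^2.\<close>

lemma Lp_bound_dual:
  assumes bd: "Lp_bound (S t) p q C" and "t \<ge> 0" "p > 1" "q > 1" "C \<ge> 0"
  shows "Lp_bound (S t) (q / (q - 1)) (p / (p - 1)) C"
proof (rule Lp_bound_dense)
  fix f :: "'a \<Rightarrow> real" assume f: "f \<in> Lp 2" "f \<in> Lp (q / (q - 1))"
  have pairing: "(LINT x|lebesgue. S t f x * g x) \<le> C * Lp_norm (q / (q - 1)) f * Lp_norm p g"
    if g: "g \<in> Lp 2" "g \<in> Lp p" for g
  proof -
    have Sg: "S t g \<in> Lp q" "Lp_norm q (S t g) \<le> C * Lp_norm p g"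
      using bd g by (auto simp: Lp_bound_def)
    have "(LINT x|lebesgue. S t f x * g x) = (LINT x|lebesgue. f x * S t g x)"
      by (rule S_symmetric) fact+
    also have "\<dots> \<le> Lp_norm (q / (q - 1)) f * Lp_norm q (S t g)"
      using Holder_inequality(2)[of "q / (q - 1)" q f "S t g"] f Sg \<open>q > 1\<close> by (auto simp: field_simps)
    also have "\<dots> \<le> Lp_norm (q / (q - 1)) f * (C * Lp_norm p g)"
      by (rule mult_left_mono[OF Sg(2) Lp_norm_nonneg])
    finally show ?thesis
      by (simp add: mult_ac)
  qed
  show "S t f \<in> Lp (p / (p - 1)) \<and> Lp_norm (p / (p - 1)) (S t f) \<le> C * Lp_norm (q / (q - 1)) f"
    by (intro conjI; rule converse_Holder[OF S_Lp[OF _ \<open>t \<ge> 0\<close> f(1)] _ _ _ _ _ pairing])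
      (use assms in \<open>auto simp: field_simps Lp_norm_nonneg\<close>)
qed (use assms in \<open>auto simp: field_simps\<close>)

section \<open>Bounds into L^infinity, and bounds at time zero\<close>

lemma Linf_bound_AE:
  assumes "Linf_bound (S t) p C" "f \<in> Lp p"
  shows "AE x in lebesgue. \<bar>S t f x\<bar> \<le> C * Lp_norm p f"
proof -
  have le: "esssup lebesgue (\<lambda>x. ereal \<bar>S t f x\<bar>) \<le> ereal (C * Lp_norm p f)"
    using assms by (simp add: Linf_bound_def)
  show ?thesis
    using esssup_AE[of "\<lambda>x. ereal \<bar>S t f x\<bar>" lebesgue]
  proof eventually_elim
    case (elim x)
    then have "ereal \<bar>S t f x\<bar> \<le> ereal (C * Lp_norm p f)" using le by (rule order.trans)
    then show ?case by simp
  qed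
qed

text \<open>The same duality with the pairing of L^1 and L^infinity, where an almost everywhere
  bound on \<open>S t g\<close> takes the place of Hoelder's inequality.\<close>

lemma Linf_bound_dual:
  assumes bd: "Linf_bound (S t) p C" and "t \<ge> 0" "p > 1" "C \<ge> 0"
  shows "Lp_bound (S t) 1 (p / (p - 1)) C"
proof (rule Lp_bound_dense)
  fix f :: "'a \<Rightarrow> real" assume f: "f \<in> Lp 2" "f \<in> Lp 1"
  have pairing: "(LINT x|lebesgue. S t f x * g x) \<le> C * Lp_norm 1 f * Lp_norm p g"
    if g: "g \<in> Lp 2" "g \<in> Lp p" for g
  proof -
    have Sg: "AE x in lebesgue. \<bar>S t g x\<bar> \<le> C * Lp_norm p g"
      by (rule Linf_bound_AE[OF bd g(2)])
    have Sg2: "S t g \<in> Lp 2" using S_Lp[of 2 t g] g \<open>t \<ge> 0\<close> by simp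
    have int: "integrable lebesgue (\<lambda>x. \<bar>f x\<bar>)" using Lp_integrable[OF f(2)] by simp
    have "(LINT x|lebesgue. S t f x * g x) = (LINT x|lebesgue. f x * S t g x)"
      by (rule S_symmetric) fact+
    also have "\<dots> \<le> (LINT x|lebesgue. \<bar>f x\<bar> * (C * Lp_norm p g))"
    proof (rule integral_mono_AE[OF L2_inner(1)[OF f(1) Sg2]])
      show "AE x in lebesgue. f x * S t g x \<le> \<bar>f x\<bar> * (C * Lp_norm p g)"
        using Sg
      proof eventually_elim
        case (elim x)
        have "f x * S t g x \<le> \<bar>f x\<bar> * \<bar>S t g x\<bar>" by (metis abs_ge_self abs_mult)
        also have "\<dots> \<le> \<bar>f x\<bar> * (C * Lp_norm p g)" using elim by (intro mult_left_mono) auto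
        finally show ?case .
      qed
    qed (use int in simp)
    also have "\<dots> = C * Lp_norm 1 f * Lp_norm p g" by (simp add: Lp_norm_1)
    finally show ?thesis .
  qed
  show "S t f \<in> Lp (p / (p - 1)) \<and> Lp_norm (p / (p - 1)) (S t f) \<le> C * Lp_norm 1 f"
    by (intro conjI; rule converse_Holder[OF S_Lp[OF _ \<open>t \<ge> 0\<close> f(1)] _ _ _ _ _ pairing])
      (use assms in \<open>auto simp: field_simps Lp_norm_nonneg\<close>)
qed (use assms in auto)

text \<open>At time 0 the map is the identity on L^2, and indicators of very small sets rule out any
  gain of integrability. This settles the starting exponent when the transition time is 0.\<close>

lemma Lp_bound_0_imp_eq:
  assumes bd: "Lp_bound (S 0) p q C" and "1 \<le> p" "p \<le> q"
  shows "p = q"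
proof (rule ccontr)
  assume "p \<noteq> q"
  with assms have pq: "p < q" by simp
  define d where "d = 1 / p - 1 / q"
  have d: "d > 0" using pq \<open>1 \<le> p\<close> by (simp add: d_def field_simps)
  \<comment> \<open>Chosen so that \<open>m powr d\<close> equals
    \<open>1 / (\<bar>C\<bar> + 1)\<close>, which makes \<open>C * m powr d\<close> less than
    1.\<close>
  define m where "m = (\<bar>C\<bar> + 1) powr (- 1 / d)"
  have m: "m > 0" by (simp add: m_def)
  obtain E :: "'a set" where E: "E \<in> sets lebesgue" "emeasure lebesgue E = ennreal m"
    using exists_lebesgue_measure[OF m] .
  define f :: "'a \<Rightarrow> real" where "f = indicator E"
  have pw: "(\<lambda>x. \<bar>f x\<bar> powr r) = indicator E" for r by (auto simp: f_def indicator_def)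
  have f: "f \<in> Lp r" for r
    unfolding Lp_def using E by (simp add: pw) (simp add: f_def)
  have norm: "Lp_norm r f = m powr (1 / r)" for r
    using E m by (simp add: Lp_norm_def pw measure_def)
  have S0: "S 0 f \<in> Lp q" "Lp_norm q (S 0 f) \<le> C * Lp_norm p f"
    using bd f by (auto simp: Lp_bound_def)
  have "Lp_norm q (S 0 f) = Lp_norm q f"
    by (rule Lp_norm_cong_AE[OF S_zero[OF f]]) (use S0 f Lp_measurable in auto)
  then have "m powr (1 / q) \<le> C * m powr (1 / p)" using S0 norm by simp
  also have "m powr (1 / p) = m powr d * m powr (1 / q)" by (simp add: d_def flip: powr_add)
  finally have "1 \<le> C * m powr d" using m by simp
  moreover have "m powr d = 1 / (\<bar>C\<bar> + 1)"
    unfolding m_def powr_powr using d by (simp add: powr_minus_divide)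
  ultimately show False by (simp add: field_simps)
qed

end

section \<open>Hypercontractivity\<close>

text \<open>Assembles a coefficient function from bounds with unspecified constants while
  prescribing its value at one time \<open>t\<close>. For monotone \<open>Q\<close>, being unbounded
  already gives the limit.\<close>

lemma hypercontractive_withI:
  fixes S :: "real \<Rightarrow> ('a::euclidean_space \<Rightarrow> real) \<Rightarrow> 'a \<Rightarrow> real"
  assumes tinf: "0 < tinf" and mono: "mono_on {t. 0 \<le> t \<and> ereal t < tinf} Q" and Q0: "Q 0 = p"
    and unbdd: "\<And>B. \<exists>s\<ge>0. ereal s < tinf \<and> B \<le> Q s"
    and bdd: "\<And>s. 0 \<le> s \<Longrightarrow> ereal s < tinf \<Longrightarrow> \<exists>C. Lp_bound (S s) p (Q s) C"
    and t: "0 \<le> t" "ereal t < tinf" "Lp_bound (S t) p (Q t) B" "0 \<le> B" "t = 0 \<Longrightarrow> 1 \<le> B"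
  shows "\<exists>A. hypercontractive_with S p tinf Q A \<and> A t = B"
proof -
  \<comment> \<open>The maximum with 1 secures both nonnegativity and \<open>1 \<le> A 0\<close>
    when \<open>t\<close> is not 0.\<close>
  define A where "A s = (if s = t then B else max 1 (SOME C. Lp_bound (S s) p (Q s) C))" for s
  have A: "Lp_bound (S s) p (Q s) (A s)" if "0 \<le> s" "ereal s < tinf" for s
  proof (cases "s = t")
    case False
    have "Lp_bound (S s) p (Q s) (SOME C. Lp_bound (S s) p (Q s) C)"
      by (rule someI_ex[OF bdd[OF that]])
    then show ?thesis using False by (auto simp: A_def intro: Lp_bound_mono)
  qed (use t in \<open>simp add: A_def\<close>)
  have ge: "p \<le> Q s" if "0 \<le> s" "ereal s < tinf" for s
    using mono_onD[OF mono, of 0 s] that tinf Q0 by (auto simp: zero_ereal_def)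
  \<comment> \<open>Once \<open>Q s\<close> has passed \<open>Z\<close>, monotonicity keeps it there
    up to \<open>tinf\<close>. Points between \<open>ereal s\<close> and \<open>tinf\<close> are
    real, also when \<open>tinf\<close> is infinite.\<close>
  have "filterlim (\<lambda>t. Q (real_of_ereal t)) at_top (at_left tinf)"
    unfolding filterlim_at_top
  proof
    fix Z
    obtain s where s: "0 \<le> s" "ereal s < tinf" "Z \<le> Q s" using unbdd by blast
    have "Z \<le> Q (real_of_ereal y)" if y: "ereal s < y" "y < tinf" for y
    proof (cases y)
      case (real r)
      then have "Q s \<le> Q r" using mono_onD[OF mono, of s r] s y by auto
      then show ?thesis using real s by simp
    qed (use y in auto)
    then show "eventually (\<lambda>x. Z \<le> Q (real_of_ereal x)) (at_left tinf)"
      unfolding eventually_at_left[OF tinf] using s(2) by blast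
  qed
  then have "hypercontractive_with S p tinf Q A"
    unfolding hypercontractive_with_def using tinf mono Q0 A ge t
    by (auto simp: A_def)
  then show ?thesis by (auto simp: A_def)
qed

lemma hypercontractive_with_unbounded:
  assumes "hypercontractive_with S p tinf Q A"
  shows "\<exists>s>0. ereal s < tinf \<and> B \<le> Q s"
proof -
  have tinf: "0 < tinf" and "filterlim (\<lambda>t. Q (real_of_ereal t)) at_top (at_left tinf)"
    using assms by (auto simp: hypercontractive_with_def)
  then have "eventually (\<lambda>x. B \<le> Q (real_of_ereal x)) (at_left tinf)"
    by (simp add: filterlim_at_top)
  then obtain b where b: "b < tinf" "\<And>y. b < y \<Longrightarrow> y < tinf \<Longrightarrow> B \<le> Q (real_of_ereal y)"
    unfolding eventually_at_left[OF tinf] by blast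
  obtain y where y: "max b 0 < y" "y < tinf" using dense[of "max b 0" tinf] b(1) tinf by auto
  then obtain r where r: "y = ereal r" by (cases y) auto
  show ?thesis using b(2)[of y] y by (intro exI[of _ r]) (auto simp: r)
qed

section \<open>Hypercontractivity below exponent 2\<close>

context heat_flow
begin

text \<open>The dual bound fixes the coefficient at time \<open>t\<close>; the remaining times are
  filled by waiting and by composing with the flow that starts from L^2.\<close>

lemma hypercontractive_with_dual:
  assumes H: "hypercontractive_with S 2 T Q A"
    and bd: "Lp_bound (S t) p q B" and t: "0 \<le> t" and pq: "2 \<le> p" "p \<le> q" and "0 \<le> B"
    and t0: "t = 0 \<Longrightarrow> p = q \<and> 1 \<le> B"
  shows "\<exists>T' Q' A'. hypercontractive_with S (q / (q - 1)) T' Q' A' \<and>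
    ereal t < T' \<and> Q' t = p / (p - 1) \<and> A' t = B"
proof -
  define p' q' where "p' = p / (p - 1)" and "q' = q / (q - 1)"
  have ord: "1 < q'" "q' \<le> p'" "p' \<le> 2" using pq by (auto simp: p'_def q'_def field_simps)
  have T: "0 < T" and Q0: "Q 0 = 2" and Qmono: "mono_on {t. 0 \<le> t \<and> ereal t < T} Q"
    using H by (auto simp: hypercontractive_with_def)
  have Q2: "2 \<le> Q s" "0 \<le> A s" "Lp_bound (S s) 2 (Q s) (A s)" if "0 \<le> s" "ereal s < T" for s
    using H that by (auto simp: hypercontractive_with_def)
  have dual: "Lp_bound (S t) q' p' B"
    unfolding p'_def q'_def by (rule Lp_bound_dual[OF bd]) (use t pq \<open>0 \<le> B\<close> in auto)
  obtain s0 where s0: "0 < s0" "ereal s0 < T" "p \<le> Q s0"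
    using hypercontractive_with_unbounded[OF H] by blast
  obtain C where C: "0 \<le> C" "Lp_bound (S s0) p' 2 C"
  proof -
    obtain D where D: "Lp_bound (S s0) 2 2 D" using Lp_bound_diag[of 2 s0] s0 by auto
    \<comment> \<open>At time \<open>s0\<close> the operator maps L^2 to itself and to an exponent
      at least \<open>p\<close>, hence to L^p; the dual of that bound maps L^p' to L^2.\<close>
    obtain C where C: "0 \<le> C" "Lp_bound (S s0) 2 p C"
      using Lp_bound_interpolation[OF D Q2(3)[of s0], of p] s0 pq by auto
    show ?thesis using that[of C] Lp_bound_dual[OF C(2)] C(1) s0 pq by (simp add: p'_def)
  qed
  define T' where "T' = T + ereal (t + s0)"
  \<comment> \<open>Wait at \<open>q'\<close>, then at \<open>p'\<close>, then follow
    \<open>Q\<close> delayed by \<open>t + s0\<close>. The comparison \<open>s < t\<close> is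
    strict, so that the value at \<open>t\<close> itself is already \<open>p'\<close>.\<close>
  define Q' where "Q' s = (if s < t then q' else if s < t + s0 then p' else Q (s - (t + s0)))" for s
  have T': "ereal s < T' \<longleftrightarrow> ereal (s - (t + s0)) < T" for s
    by (cases T) (auto simp: T'_def)
  have mono: "mono_on {s. 0 \<le> s \<and> ereal s < T'} Q'"
  proof (rule mono_onI)
    fix r s assume rs: "r \<in> {s. 0 \<le> s \<and> ereal s < T'}" "s \<in> {s. 0 \<le> s \<and> ereal s < T'}" "r \<le> s"
    show "Q' r \<le> Q' s"
    proof (cases "r < t + s0")
      case True
      then have "Q' r \<le> p'" "r < t \<Longrightarrow> Q' r = q'" using ord by (auto simp: Q'_def)
      moreover have "p' \<le> Q (s - (t + s0))" if "\<not> s < t + s0"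
        using Q2(1)[of "s - (t + s0)"] rs T' that ord by auto
      ultimately show ?thesis using ord rs(3) by (auto simp: Q'_def)
    next
      case False
      then show ?thesis
        using mono_onD[OF Qmono, of "r - (t + s0)" "s - (t + s0)"] rs T' s0 by (auto simp: Q'_def)
    qed
  qed
  have "\<exists>A'. hypercontractive_with S q' T' Q' A' \<and> A' t = B"
  proof (rule hypercontractive_withI[OF _ mono])
    show "0 < T'" using T' [of 0] T t s0 by (cases T) (auto simp: T'_def zero_ereal_def)
    show "ereal t < T'" using T t s0 by (subst T') (auto simp: zero_ereal_def intro: le_less_trans[of _ 0])
    \<comment> \<open>If \<open>t = 0\<close>, the first phase is empty and \<open>Q' 0\<close> is
      \<open>p'\<close>; then \<open>p = q\<close> makes it equal to \<open>q'\<close>.\<close>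
    show "Q' 0 = q'" using t t0 s0 by (auto simp: Q'_def p'_def q'_def)
    show "Lp_bound (S t) q' (Q' t) B" using dual s0 by (simp add: Q'_def)
    show "\<exists>s\<ge>0. ereal s < T' \<and> b \<le> Q' s" for b
    proof -
      obtain s where "0 < s" "ereal s < T" "b \<le> Q s"
        using hypercontractive_with_unbounded[OF H] by blast
      then show ?thesis using t s0 by (intro exI[of _ "s + (t + s0)"]) (auto simp: T' Q'_def)
    qed
    show "\<exists>C. Lp_bound (S s) q' (Q' s) C" if s: "0 \<le> s" "ereal s < T'" for s
    proof -
      consider "s < t" | "t \<le> s" "s < t + s0" | "t + s0 \<le> s" by linarith
      then show ?thesis
      proof cases
        case 1
        then show ?thesis using Lp_bound_diag[of q' s] ord s by (auto simp: Q'_def)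
      next
        case 2
        obtain D where D: "0 \<le> D" "Lp_bound (S (s - t)) p' p' D"
          using Lp_bound_diag[of p' "s - t"] 2 ord by auto
        show ?thesis
          using Lp_bound_compose[OF dual D(2) t] 2 ord D \<open>0 \<le> B\<close> by (auto simp: Q'_def)
      next
        case 3
        define r where "r = s - (t + s0)"
        have r: "0 \<le> r" "ereal r < T" "s = t + s0 + r" using 3 s T' by (auto simp: r_def)
        \<comment> \<open>The chain of exponents \<open>q'\<close>, \<open>p'\<close>, 2,
          \<open>Q r\<close> is traversed in the successive times \<open>t\<close>,
          \<open>s0\<close>, \<open>r\<close>.\<close>
        have "Lp_bound (S (t + s0)) q' 2 (C * B)"
          by (rule Lp_bound_compose[OF dual C(2)]) (use t s0 ord C \<open>0 \<le> B\<close> in auto)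
        then have "Lp_bound (S (t + s0 + r)) q' (Q r) (A r * (C * B))"
          by (rule Lp_bound_compose[OF _ Q2(3)[OF r(1,2)]])
            (use t s0 ord C \<open>0 \<le> B\<close> r Q2[OF r(1,2)] in auto)
        then show ?thesis using r t s0 by (auto simp: Q'_def)
      qed
    qed
  qed (use t0 t \<open>0 \<le> B\<close> in auto)
  moreover have "ereal t < T'"
    using T t s0 by (subst T') (auto simp: zero_ereal_def intro: le_less_trans[of _ 0])
  moreover have "Q' t = p'" using s0 by (simp add: Q'_def)
  ultimately show ?thesis unfolding p'_def q'_def by blast
qed

text \<open>The bound from L^2 serves twice: dualised it leads from L^1 to L^2, and directly from
  L^2 to L^infinity. With boundedness on L^1 this reaches every finite exponent.\<close>

lemma ultracontractive_imp_hypercontractive_1: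
  assumes bd: "Linf_bound (S t) 2 C" and t: "0 \<le> t" and C: "0 \<le> C"
  shows "hypercontractive S 1"
proof -
  \<comment> \<open>Two steps of length \<open>t\<close> are needed before the exponent may rise.
    The extra 1 makes the later values \<open>s\<close> at least 1 and gives \<open>Q 0 = 1\<close>
    also for \<open>t = 0\<close>.\<close>
  define Q where "Q s = (if s < 2 * t + 1 then 1 else s)" for s :: real
  have bounds: "\<exists>D\<ge>0. Lp_bound (S s) 1 (Q s) D" if s: "0 \<le> s" for s
  proof (cases "s < 2 * t + 1")
    case True
    then show ?thesis using Lp_bound_diag[of 1 s] s by (simp add: Q_def)
  next
    case False
    obtain D1 where D1: "0 \<le> D1" "Lp_bound (S (s - 2 * t)) 1 1 D1"
      using Lp_bound_diag[of 1 "s - 2 * t"] False by auto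
    obtain D2 where D2: "0 \<le> D2" "Lp_bound (S s) 1 1 D2"
      using Lp_bound_diag[of 1 s] s by auto
    have dual: "Lp_bound (S t) 1 2 C" using Linf_bound_dual[OF bd t _ C] by simp
    have mid: "Lp_bound (S (s - 2 * t + t)) 1 2 (C * D1)"
      by (rule Lp_bound_compose[OF D1(2) dual]) (use False t C D1 in auto)
    \<comment> \<open>One constant for both the uniform bound and the L^1 bound, as the
      interpolation requires.\<close>
    define K where "K = max (C * (C * D1)) D2"
    have K: "0 \<le> K" using D2 by (simp add: K_def)
    have "Lp_bound (S s) 1 s K"
    proof (rule Lp_bound_dense)
      fix f :: "'a \<Rightarrow> real" assume f: "f \<in> Lp 2" "f \<in> Lp 1"
      have g: "S (s - t) f \<in> Lp 2" "Lp_norm 2 (S (s - t) f) \<le> C * D1 * Lp_norm 1 f"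
        using mid f by (auto simp: Lp_bound_def)
      have "AE x in lebesgue. \<bar>S t (S (s - t) f) x\<bar> \<le> C * Lp_norm 2 (S (s - t) f)"
        by (rule Linf_bound_AE[OF bd g(1)])
      moreover have "AE x in lebesgue. S s f x = S t (S (s - t) f) x"
        using S_add[OF f(1) t, of "s - t"] False t by simp
      ultimately have "AE x in lebesgue. \<bar>S s f x\<bar> \<le> K * Lp_norm 1 f"
      proof eventually_elim
        case (elim x)
        have "C * Lp_norm 2 (S (s - t) f) \<le> C * (C * D1) * Lp_norm 1 f"
          using mult_left_mono[OF g(2) C] by (simp add: mult.assoc)
        also have "\<dots> \<le> K * Lp_norm 1 f"
          by (rule mult_right_mono) (auto simp: K_def Lp_norm_nonneg)
        finally show ?case using elim by simp
      qed
      moreover have "S s f \<in> Lp 1" "Lp_norm 1 (S s f) \<le> K * Lp_norm 1 f"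
        using D2(2) f mult_right_mono[of D2 K "Lp_norm 1 f"]
        by (auto simp: Lp_bound_def K_def Lp_norm_nonneg intro: order.trans)
      ultimately show "S s f \<in> Lp s \<and> Lp_norm s (S s f) \<le> K * Lp_norm 1 f"
        using Lp_Linf_interpolation[of "S s f" 1 "K * Lp_norm 1 f" s] False t by auto
    qed (use s False t K in auto)
    then show ?thesis using False K by (auto simp: Q_def)
  qed
  obtain D where D: "Lp_bound (S 0) 1 (Q 0) D" using bounds[of 0] by auto
  have "\<exists>A. hypercontractive_with S 1 \<infinity> Q A \<and> A 0 = max 1 D"
  proof (rule hypercontractive_withI)
    show "mono_on {s. 0 \<le> s \<and> ereal s < \<infinity>} Q" using t by (auto simp: Q_def intro!: mono_onI)
    show "\<exists>s\<ge>0. ereal s < \<infinity> \<and> B \<le> Q s" for B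
      using t by (intro exI[of _ "\<bar>B\<bar> + (2 * t + 1)"]) (auto simp: Q_def)
    show "Lp_bound (S 0) 1 (Q 0) (max 1 D)" by (rule Lp_bound_mono[OF D]) simp
    show "\<exists>C. Lp_bound (S s) 1 (Q s) C" if "0 \<le> s" for s using bounds[OF that] by blast
  qed (use t in \<open>auto simp: Q_def\<close>)
  then show ?thesis unfolding hypercontractive_def by blast
qed

end

theorem proposition3p14:
  fixes J :: "'a::euclidean_space \<Rightarrow> 'a \<Rightarrow> real"
    and S :: "real \<Rightarrow> ('a \<Rightarrow> real) \<Rightarrow> 'a \<Rightarrow> real"
    and tinf :: "real \<Rightarrow> ereal"
    and Q A :: "real \<Rightarrow> real \<Rightarrow> real"
    and T :: "real \<Rightarrow> real"
  assumes "levy_kernel J"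
    and "heat_semigroup J S"
  shows
    "((\<forall>p\<ge>2. hypercontractive_with S p (tinf p) (Q p) (A p)) \<longrightarrow>
        (\<forall>p q t. 2 \<le> p \<and> p \<le> q \<and> 0 \<le> t \<and> ereal t < tinf p \<and> Lp_bound (S t) p q (A p t) \<longrightarrow>
           Lp_bound (S t) (q / (q - 1)) (p / (p - 1)) (A p t) \<and>
           (\<exists>tinf' Q' A'. hypercontractive_with S (q / (q - 1)) tinf' Q' A' \<and>
              ereal t < tinf' \<and> Q' t = p / (p - 1) \<and> A' t = A p t)) \<and>
        (\<forall>p. 1 < p \<and> p \<le> 2 \<longrightarrow> hypercontractive S p)) \<and>
     ((\<forall>p\<ge>2. 0 \<le> T p \<and> 0 \<le> A p (T p) \<and> Linf_bound (S (T p)) p (A p (T p))) \<longrightarrow>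
        (\<forall>p\<ge>2. Lp_bound (S (T p)) 1 (p / (p - 1)) (A p (T p))) \<and>
        hypercontractive S 1)"
proof (intro conjI impI allI)
  interpret heat_flow J S by standard (rule assms(2))
  assume H: "\<forall>p\<ge>2. hypercontractive_with S p (tinf p) (Q p) (A p)"
  have A0: "1 \<le> A p 0" and tinf0: "0 < tinf p" and Q0: "Q p 0 = p" if "2 \<le> p" for p
    using H that by (auto simp: hypercontractive_with_def)
  have A: "0 \<le> A p t" "Lp_bound (S t) p (Q p t) (A p t)" if "2 \<le> p" "0 \<le> t" "ereal t < tinf p" for p t
    using H that by (auto simp: hypercontractive_with_def)
  have dual: "\<exists>tinf' Q' A'. hypercontractive_with S (q / (q - 1)) tinf' Q' A' \<and>
              ereal t < tinf' \<and> Q' t = p / (p - 1) \<and> A' t = A p t"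
    if a: "2 \<le> p" "p \<le> q" "0 \<le> t" "ereal t < tinf p" "Lp_bound (S t) p q (A p t)" for p q t
  proof (rule hypercontractive_with_dual)
    show "hypercontractive_with S 2 (tinf 2) (Q 2) (A 2)" using H by simp
    \<comment> \<open>A transition time of 0 occurs only for equal exponents, and there the
      coefficient is \<open>A p 0\<close>.\<close>
    show "p = q \<and> 1 \<le> A p t" if "t = 0" using a A0[of p] Lp_bound_0_imp_eq[of p q "A p t"] that by simp
  qed (use a A in auto)
  {
    fix p q t
    assume "2 \<le> p \<and> p \<le> q \<and> 0 \<le> t \<and> ereal t < tinf p \<and> Lp_bound (S t) p q (A p t)"
    then have a: "2 \<le> p" "p \<le> q" "0 \<le> t" "ereal t < tinf p" "Lp_bound (S t) p q (A p t)" by auto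
    show "Lp_bound (S t) (q / (q - 1)) (p / (p - 1)) (A p t)"
      by (rule Lp_bound_dual) (use a A in auto)
    show "\<exists>tinf' Q' A'. hypercontractive_with S (q / (q - 1)) tinf' Q' A' \<and>
              ereal t < tinf' \<and> Q' t = p / (p - 1) \<and> A' t = A p t"
      by (rule dual[OF a])
  }
  fix p :: real assume p: "1 < p \<and> p \<le> 2"
  define P where "P = p / (p - 1)"
  have P: "2 \<le> P" "P / (P - 1) = p" using p by (auto simp: P_def field_simps)
  show "hypercontractive S p"
    \<comment> \<open>The trivial transition from \<open>P\<close> to itself at time 0, dualised,
      starts a hypercontractive flow at the conjugate exponent of \<open>P\<close>, which is
      \<open>p\<close>.\<close>
    using dual[OF P(1) order.refl order.refl] tinf0[OF P(1)] A(2)[OF P(1), of 0] Q0[OF P(1)]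
    unfolding P(2) hypercontractive_def by (auto simp: zero_ereal_def)
next
  interpret heat_flow J S by standard (rule assms(2))
  assume H: "\<forall>p\<ge>2. 0 \<le> T p \<and> 0 \<le> A p (T p) \<and> Linf_bound (S (T p)) p (A p (T p))"
  show "Lp_bound (S (T p)) 1 (p / (p - 1)) (A p (T p))" if "2 \<le> p" for p
    by (rule Linf_bound_dual) (use H that in auto)
  show "hypercontractive S 1"
    \<comment> \<open>The exponent 2 is its own conjugate, so the bound at time \<open>T 2\<close>
      can be composed with its dual.\<close>
    by (rule ultracontractive_imp_hypercontractive_1[of "T 2" "A 2 (T 2)"]) (use H in auto)
qed

end
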